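(* For a finite structure $M$ of order $n$ whose vocabulary has maximum relation arity $k$, $$D_1(M)\le\max\left\{\left(1-\frac1{2k}\right)n+k^2-k+2,\ \sigma(M)+k\right\},$$ where $D_1(M)$ is the minimum quantifier rank of a first-order formula with alternation number at most $1$ that defines $M$.
   Context: A vocabulary $L$ is a finite list of relation symbols with positive integer arities; maximum relation arity = largest arity. An $L$-structure $M$ has a finite universe $V(M)$ and relations $R^M:V(M)^l\to\{0,1\}$ for each $l$-ary symbol $R$; its order is $|V(M)|$. For $a,b\in V(M)$, $a\sim b$ means the transposition of $a$ and $b$ is an automorphism of $M$; this is an equivalence relation, and $\sigma(M)$ is the maximum size of a $\sim$-equivalence class. First-order formulas are over $L\cup\{=\}$ with $\neg,\wedge,\vee$. For a formula $\Phi$, $\mathrm{nest}(\Phi)$ is defined by: $\{\text{empty word}\}$ for atomic; swap $\exists,\forall$ for $\neg\Phi$; union for $\wedge,\vee$; prefix $\exists$/$\forall$ for $\exists x\Phi$/$\forall x\Phi$. Quantifier rank = maximum word length in $\mathrm{nest}(\Phi)$; alternation number = maximum number of consecutive-letter occurrences of $\exists\forall$ or $\forall\exists$ in a word of $\mathrm{nest}(\Phi)$. A closed formula $\Phi$ defines $M$ if it is true on $M$ and false on every $L$-structure not isomorphic to $M$. *)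

theory Defs
  imports Complex_Main "HOL-Library.Extended_Real" "HOL-Combinatorics.Transposition"
begin

text \<open>
  A vocabulary is the list of the arities of its relation symbols; the symbols themselves are
  the positions \<open>i < length L\<close>.
\<close>

type_synonym vocabulary = "nat list"

definition vocabulary :: "vocabulary \<Rightarrow> bool" where
  "vocabulary L \<longleftrightarrow> (\<forall>l\<in>set L. 0 < l)"

definition max_arity :: "vocabulary \<Rightarrow> nat" where
  "max_arity L = Max (set L)"

text \<open>
  \<open>interp M i\<close> is the relation denoted by the \<open>i\<close>-th symbol. Only its values on tuples of length
  \<open>L ! i\<close> over the universe are ever consulted, so it represents a function
  \<open>V(M)\<^sup>l \<rightarrow> {0,1}\<close>.
\<close>

record 'a fo_struct =
  universe :: "'a set"
  interp :: "nat \<Rightarrow> 'a list \<Rightarrow> bool"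

definition finite_struct :: "'a fo_struct \<Rightarrow> bool" where
  "finite_struct M \<longleftrightarrow> finite (universe M) \<and> universe M \<noteq> {}"

definition struct_order :: "'a fo_struct \<Rightarrow> nat" where
  "struct_order M = card (universe M)"

definition isomorphism :: "vocabulary \<Rightarrow> ('a \<Rightarrow> 'b) \<Rightarrow> 'a fo_struct \<Rightarrow> 'b fo_struct \<Rightarrow> bool" where
  "isomorphism L f M N \<longleftrightarrow> bij_betw f (universe M) (universe N) \<and>
     (\<forall>i<length L. \<forall>xs. length xs = L ! i \<and> set xs \<subseteq> universe M \<longrightarrow>
        interp M i xs = interp N i (map f xs))"

definition isomorphic :: "vocabulary \<Rightarrow> 'a fo_struct \<Rightarrow> 'b fo_struct \<Rightarrow> bool" where
  "isomorphic L M N \<longleftrightarrow> (\<exists>f. isomorphism L f M N)"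

definition automorphism :: "vocabulary \<Rightarrow> 'a fo_struct \<Rightarrow> ('a \<Rightarrow> 'a) \<Rightarrow> bool" where
  "automorphism L M f \<longleftrightarrow> isomorphism L f M M"

definition similar :: "vocabulary \<Rightarrow> 'a fo_struct \<Rightarrow> ('a \<times> 'a) set" where
  "similar L M = {(a, b). a \<in> universe M \<and> b \<in> universe M \<and> automorphism L M (transpose a b)}"

definition sigma :: "vocabulary \<Rightarrow> 'a fo_struct \<Rightarrow> nat" where
  "sigma L M = Max (card ` (universe M // similar L M))"

datatype fm =
    Eq nat nat
  | Rel nat "nat list"
  | Neg fm
  | And fm fm
  | Or fm fm
  | Exists nat fm
  | Forall nat fm

primrec wf_fm :: "vocabulary \<Rightarrow> fm \<Rightarrow> bool" where
  "wf_fm L (Eq x y) \<longleftrightarrow> True"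
| "wf_fm L (Rel i xs) \<longleftrightarrow> i < length L \<and> length xs = L ! i"
| "wf_fm L (Neg \<phi>) \<longleftrightarrow> wf_fm L \<phi>"
| "wf_fm L (And \<phi> \<psi>) \<longleftrightarrow> wf_fm L \<phi> \<and> wf_fm L \<psi>"
| "wf_fm L (Or \<phi> \<psi>) \<longleftrightarrow> wf_fm L \<phi> \<and> wf_fm L \<psi>"
| "wf_fm L (Exists x \<phi>) \<longleftrightarrow> wf_fm L \<phi>"
| "wf_fm L (Forall x \<phi>) \<longleftrightarrow> wf_fm L \<phi>"

primrec free_vars :: "fm \<Rightarrow> nat set" where
  "free_vars (Eq x y) = {x, y}"
| "free_vars (Rel i xs) = set xs"
| "free_vars (Neg \<phi>) = free_vars \<phi>"
| "free_vars (And \<phi> \<psi>) = free_vars \<phi> \<union> free_vars \<psi>"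
| "free_vars (Or \<phi> \<psi>) = free_vars \<phi> \<union> free_vars \<psi>"
| "free_vars (Exists x \<phi>) = free_vars \<phi> - {x}"
| "free_vars (Forall x \<phi>) = free_vars \<phi> - {x}"

definition closed_fm :: "fm \<Rightarrow> bool" where
  "closed_fm \<phi> \<longleftrightarrow> free_vars \<phi> = {}"

primrec sat :: "'a fo_struct \<Rightarrow> (nat \<Rightarrow> 'a) \<Rightarrow> fm \<Rightarrow> bool" where
  "sat M e (Eq x y) \<longleftrightarrow> e x = e y"
| "sat M e (Rel i xs) \<longleftrightarrow> interp M i (map e xs)"
| "sat M e (Neg \<phi>) \<longleftrightarrow> \<not> sat M e \<phi>"
| "sat M e (And \<phi> \<psi>) \<longleftrightarrow> sat M e \<phi> \<and> sat M e \<psi>"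
| "sat M e (Or \<phi> \<psi>) \<longleftrightarrow> sat M e \<phi> \<or> sat M e \<psi>"
| "sat M e (Exists x \<phi>) \<longleftrightarrow> (\<exists>a\<in>universe M. sat M (e(x := a)) \<phi>)"
| "sat M e (Forall x \<phi>) \<longleftrightarrow> (\<forall>a\<in>universe M. sat M (e(x := a)) \<phi>)"

definition true_on :: "'a fo_struct \<Rightarrow> fm \<Rightarrow> bool" where
  "true_on M \<phi> \<longleftrightarrow> (\<forall>e. range e \<subseteq> universe M \<longrightarrow> sat M e \<phi>)"

text \<open>
  The competing structures range over universes of natural numbers; this is no restriction, see
  \<open>defines_struct_imp_false_on\<close> below.
\<close>

definition defines_struct :: "vocabulary \<Rightarrow> fm \<Rightarrow> 'a fo_struct \<Rightarrow> bool" where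
  "defines_struct L \<phi> M \<longleftrightarrow> wf_fm L \<phi> \<and> closed_fm \<phi> \<and> true_on M \<phi> \<and>
     (\<forall>N :: nat fo_struct. finite_struct N \<and> \<not> isomorphic L M N \<longrightarrow> \<not> true_on N \<phi>)"

datatype quantifier = QEx | QAll

primrec dual :: "quantifier \<Rightarrow> quantifier" where
  "dual QEx = QAll"
| "dual QAll = QEx"

primrec nest :: "fm \<Rightarrow> quantifier list set" where
  "nest (Eq x y) = {[]}"
| "nest (Rel i xs) = {[]}"
| "nest (Neg \<phi>) = map dual ` nest \<phi>"
| "nest (And \<phi> \<psi>) = nest \<phi> \<union> nest \<psi>"
| "nest (Or \<phi> \<psi>) = nest \<phi> \<union> nest \<psi>"
| "nest (Exists x \<phi>) = (#) QEx ` nest \<phi>"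
| "nest (Forall x \<phi>) = (#) QAll ` nest \<phi>"

definition quantifier_rank :: "fm \<Rightarrow> nat" where
  "quantifier_rank \<phi> = Max (length ` nest \<phi>)"

definition alternations :: "quantifier list \<Rightarrow> nat" where
  "alternations w = card {i. Suc i < length w \<and> w ! i \<noteq> w ! Suc i}"

definition alternation_number :: "fm \<Rightarrow> nat" where
  "alternation_number \<phi> = Max (alternations ` nest \<phi>)"

text \<open>
  Taking the infimum in \<^typ>\<open>enat\<close> gives \<open>\<infinity>\<close>, rather than \<open>0\<close>, if there is no
  defining formula; otherwise the infimum is a minimum.
\<close>

definition D1 :: "vocabulary \<Rightarrow> 'a fo_struct \<Rightarrow> enat" where
  "D1 L M = (INF \<phi> \<in> {\<phi>. defines_struct L \<phi> M \<and> alternation_number \<phi> \<le> 1}.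
     enat (quantifier_rank \<phi>))"


lemma finite_nest: "finite (nest \<phi>)"
  by (induction \<phi>) auto

lemma nest_nonempty: "nest \<phi> \<noteq> {}"
  by (induction \<phi>) auto

lemma isomorphism_inv:
  assumes "isomorphism L f M N"
  shows "isomorphism L (inv_into (universe M) f) N M"
proof -
  let ?g = "inv_into (universe M) f"
  have bij: "bij_betw f (universe M) (universe N)"
    using assms by (simp add: isomorphism_def)
  have g: "bij_betw ?g (universe N) (universe M)"
    by (rule bij_betw_inv_into[OF bij])
  have "interp N i ys = interp M i (map ?g ys)"
    if "i < length L" "length ys = L ! i" "set ys \<subseteq> universe N" for i ys
  proof -
    have "set (map ?g ys) \<subseteq> universe M"
      using that(3) bij_betw_imp_surj_on[OF g] by auto
    moreover have "map f (map ?g ys) = ys"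
      using that(3) by (auto intro!: map_idI simp: bij_betw_inv_into_right[OF bij])
    ultimately show ?thesis
      using assms that unfolding isomorphism_def by (metis length_map)
  qed
  with g show ?thesis by (simp add: isomorphism_def)
qed

lemma isomorphism_comp:
  assumes "isomorphism L f M N" "isomorphism L g N P"
  shows "isomorphism L (g \<circ> f) M P"
proof -
  have f: "bij_betw f (universe M) (universe N)"
    using assms(1) by (simp add: isomorphism_def)
  have "interp M i xs = interp P i (map (g \<circ> f) xs)"
    if "i < length L" "length xs = L ! i" "set xs \<subseteq> universe M" for i xs
  proof -
    have "set (map f xs) \<subseteq> universe N"
      using that(3) bij_betw_imp_surj_on[OF f] by auto
    then show ?thesis
      using assms that unfolding isomorphism_def by (metis length_map map_map)
  qed
  then show ?thesis
    using assms by (auto simp: isomorphism_def intro: bij_betw_trans)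
qed

lemma sat_isomorphism:
  assumes "isomorphism L f M N" "wf_fm L \<phi>" "range e \<subseteq> universe M"
  shows "sat M e \<phi> \<longleftrightarrow> sat N (f \<circ> e) \<phi>"
  using assms(2,3)
proof (induction \<phi> arbitrary: e)
  case (Eq x y)
  have "inj_on f (universe M)"
    using assms(1) by (simp add: isomorphism_def bij_betw_def)
  then show ?case using Eq by (auto dest: inj_onD)
next
  case (Rel i xs)
  have "set (map e xs) \<subseteq> universe M"
    using Rel.prems by auto
  then have "interp M i (map e xs) = interp N i (map f (map e xs))"
    using assms(1) Rel.prems unfolding isomorphism_def by (metis length_map wf_fm.simps(2))
  then show ?case by (simp add: comp_def)
next
  case (Exists x \<phi>)
  have img: "universe N = f ` universe M"
    using assms(1) by (simp add: isomorphism_def bij_betw_def)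
  have "sat M (e(x := a)) \<phi> \<longleftrightarrow> sat N ((f \<circ> e)(x := f a)) \<phi>" if "a \<in> universe M" for a
  proof -
    have "range (e(x := a)) \<subseteq> universe M" using Exists.prems that by auto
    then have "sat M (e(x := a)) \<phi> \<longleftrightarrow> sat N (f \<circ> e(x := a)) \<phi>"
      using Exists by (metis wf_fm.simps(6))
    then show ?thesis by (simp only: fun_upd_comp)
  qed
  then show ?case by (simp add: img comp_def)
next
  case (Forall x \<phi>)
  have img: "universe N = f ` universe M"
    using assms(1) by (simp add: isomorphism_def bij_betw_def)
  have "sat M (e(x := a)) \<phi> \<longleftrightarrow> sat N ((f \<circ> e)(x := f a)) \<phi>" if "a \<in> universe M" for a
  proof -
    have "range (e(x := a)) \<subseteq> universe M" using Forall.prems that by auto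
    then have "sat M (e(x := a)) \<phi> \<longleftrightarrow> sat N (f \<circ> e(x := a)) \<phi>"
      using Forall by (metis wf_fm.simps(7))
    then show ?thesis by (simp only: fun_upd_comp)
  qed
  then show ?case by (simp add: img comp_def)
qed auto

lemma true_on_isomorphism:
  assumes "isomorphism L f M N" "wf_fm L \<phi>" "true_on M \<phi>"
  shows "true_on N \<phi>"
  unfolding true_on_def
proof (intro allI impI)
  fix e :: "nat \<Rightarrow> _" assume e: "range e \<subseteq> universe N"
  let ?g = "inv_into (universe M) f"
  have g: "isomorphism L ?g N M" by (rule isomorphism_inv[OF assms(1)])
  then have "range (?g \<circ> e) \<subseteq> universe M"
    using e by (auto simp: isomorphism_def bij_betw_def)
  then have "sat M (?g \<circ> e) \<phi>" using assms(3) by (simp add: true_on_def)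
  then show "sat N e \<phi>" using sat_isomorphism[OF g assms(2) e] by simp
qed

lemma isomorphic_nat_struct:
  fixes N :: "'b fo_struct"
  assumes "finite_struct N"
  obtains N' :: "nat fo_struct" and g where "finite_struct N'" "isomorphism L g N N'"
proof -
  obtain g where g: "bij_betw g (universe N) {0..<card (universe N)}"
    using assms ex_bij_betw_finite_nat by (auto simp: finite_struct_def)
  define N' where "N' = \<lparr>universe = {0..<card (universe N)},
    interp = (\<lambda>i xs. interp N i (map (inv_into (universe N) g) xs))\<rparr>"
  have "map (inv_into (universe N) g \<circ> g) xs = xs" if "set xs \<subseteq> universe N" for xs
    using that by (auto intro!: map_idI simp: bij_betw_inv_into_left[OF g])
  then have "isomorphism L g N N'"
    using g by (simp add: isomorphism_def N'_def)
  moreover have "finite_struct N'"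
    using assms by (auto simp: finite_struct_def N'_def card_gt_0_iff)
  ultimately show thesis by (rule that[rotated])
qed

lemma defines_struct_imp_false_on:
  fixes M :: "'a fo_struct" and N :: "'b fo_struct"
  assumes "defines_struct L \<phi> M" "finite_struct N" "\<not> isomorphic L M N"
  shows "\<not> true_on N \<phi>"
proof
  assume N: "true_on N \<phi>"
  obtain N' :: "nat fo_struct" and g where N': "finite_struct N'" "isomorphism L g N N'"
    using isomorphic_nat_struct[OF assms(2)] by blast
  have "true_on N' \<phi>"
    using true_on_isomorphism[OF N'(2) _ N] assms(1) by (simp add: defines_struct_def)
  then have "isomorphic L M N'"
    using assms(1) N'(1) by (auto simp: defines_struct_def)
  then have "isomorphic L M N"
    using isomorphism_comp isomorphism_inv[OF N'(2)] unfolding isomorphic_def by blast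
  with assms(3) show False by simp
qed

lemma equiv_similar: "equiv (universe M) (similar L M)"
proof (rule equivI)
  show "similar L M \<subseteq> universe M \<times> universe M" by (auto simp: similar_def)
  show "refl_on (universe M) (similar L M)"
    by (auto simp: refl_on_def similar_def automorphism_def isomorphism_def)
  show "sym (similar L M)"
    by (auto simp: sym_def similar_def transpose_commute)
  show "trans (similar L M)"
  proof (rule transI)
    fix a b c assume ab: "(a, b) \<in> similar L M" and bc: "(b, c) \<in> similar L M"
    show "(a, c) \<in> similar L M"
    proof (cases "a = b \<or> b = c \<or> a = c")
      case True
      then show ?thesis
        using ab bc by (auto simp: similar_def automorphism_def isomorphism_def)
    next
      case False
      then have eq: "transpose a c = transpose a b \<circ> (transpose b c \<circ> transpose a b)"
        by (auto simp: fun_eq_iff transpose_def)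
      have "isomorphism L (transpose a b) M M" "isomorphism L (transpose b c) M M"
        using ab bc by (auto simp: similar_def automorphism_def)
      then have "isomorphism L (transpose a c) M M"
        unfolding eq by (intro isomorphism_comp)
      then show ?thesis
        using ab bc by (simp add: similar_def automorphism_def)
    qed
  qed
qed

end

theory Submission
  imports Defs
begin

text \<open>
  By the game characterisation it suffices that the Spoiler beats the Duplicator on \<open>M\<close> and any
  non-isomorphic \<open>N\<close> in the given number of rounds, changing structures at most once.

  Call \<open>a\<close> and \<open>b\<close> of the same type over \<open>D\<close> if fixing \<open>D\<close> and mapping \<open>a\<close> to \<open>b\<close> is a partial
  automorphism of \<open>M\<close>. Enlarge \<open>D\<close> by sets of at most \<open>k - 1\<close> elements as long as this increases the
  number of types; each type then costs at most \<open>k - 1\<close> elements, and a type can afterwards only be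
  split by a small set that swallows another type completely. Types with at most \<open>k\<close> elements are
  disposed of by putting one representative into a layer \<open>Y\<close> and the rest into the set \<open>X\<close> of selected
  elements. After \<open>k - 1\<close> such layers, elements of \<open>Z = V - X - Y\<close> of the same type are
  interchangeable by a transposition, and \<open>|X| + |Z| / 2 \<le> (1 - 1 / (2 k)) n\<close>.

  The Spoiler selects \<open>X\<close>. Each layer is determined by \<open>X\<close> and the preceding layers, so violating the
  induced matching loses within \<open>(k - 1)\<^sup>2\<close> further moves. Hence two types of different size in \<open>M\<close> and
  \<open>N\<close> are detected unless both have more than \<open>|Z| / 2 + k\<close> elements. In that case there is only one
  such pair, it lies in the largest similarity classes, and the Spoiler instead selects \<open>s + 1\<close>
  mutually similar elements in the larger structure, where \<open>s \<le> \<sigma>(M)\<close> is the maximum for the smaller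
  one; then \<open>k - 1\<close> moves in the other structure expose two dissimilar answers.
\<close>


subsection \<open>Partial isomorphisms and the one-alternation game\<close>

text \<open>Positions of the game are relations rather than functions, so that exchanging the
  structures is \<open>converse\<close> and passing through a third structure is relational
  composition. The first conjunct covers well-definedness and injectivity at once.\<close>

definition partial_iso ::
  "vocabulary \<Rightarrow> 'a fo_struct \<Rightarrow> 'b fo_struct \<Rightarrow> ('a \<times> 'b) set \<Rightarrow> bool" where
  "partial_iso L M N P \<longleftrightarrow>
     (\<forall>p\<in>P. \<forall>q\<in>P. fst p = fst q \<longleftrightarrow> snd p = snd q) \<and>
     (\<forall>i<length L. \<forall>ps. length ps = L ! i \<and> set ps \<subseteq> P \<longrightarrow>
        interp M i (map fst ps) = interp N i (map snd ps))"

lemma partial_isoI: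
  assumes "\<And>a b c d. (a, b) \<in> P \<Longrightarrow> (c, d) \<in> P \<Longrightarrow> a = c \<longleftrightarrow> b = d"
    and "\<And>i ps. i < length L \<Longrightarrow> length ps = L ! i \<Longrightarrow> set ps \<subseteq> P \<Longrightarrow>
      interp M i (map fst ps) = interp N i (map snd ps)"
  shows "partial_iso L M N P"
  using assms unfolding partial_iso_def by fastforce

lemma partial_iso_eq:
  assumes "partial_iso L M N P" "(a, b) \<in> P" "(c, d) \<in> P"
  shows "a = c \<longleftrightarrow> b = d"
  using assms unfolding partial_iso_def by force

lemma partial_iso_rel:
  assumes "partial_iso L M N P" "i < length L" "length ps = L ! i" "set ps \<subseteq> P"
  shows "interp M i (map fst ps) = interp N i (map snd ps)"
  using assms unfolding partial_iso_def by blast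

lemma partial_iso_subset: "partial_iso L M N P \<Longrightarrow> Q \<subseteq> P \<Longrightarrow> partial_iso L M N Q"
  unfolding partial_iso_def by (meson subset_iff subset_trans)

lemma partial_iso_converse_aux:
  assumes "partial_iso L M N P"
  shows "partial_iso L N M (P\<inverse>)"
proof (rule partial_isoI)
  fix i ps assume ps: "i < length L" "length ps = L ! i" "set ps \<subseteq> P\<inverse>"
  have "interp M i (map fst (map prod.swap ps)) = interp N i (map snd (map prod.swap ps))"
    by (rule partial_iso_rel[OF assms]) (use ps in auto)
  then show "interp N i (map fst ps) = interp M i (map snd ps)" by (simp add: comp_def)
qed (use partial_iso_eq[OF assms] in blast)

lemma partial_iso_converse [simp]: "partial_iso L N M (P\<inverse>) \<longleftrightarrow> partial_iso L M N P"
  using partial_iso_converse_aux[of L M N P] partial_iso_converse_aux[of L N M "P\<inverse>"] by auto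

lemma partial_iso_Id_on: "partial_iso L M M (Id_on D)"
proof (rule partial_isoI)
  fix i and ps :: "('a \<times> 'a) list" assume "set ps \<subseteq> Id_on D"
  then have "map fst ps = map snd ps" by (auto simp: Id_on_def)
  then show "interp M i (map fst ps) = interp M i (map snd ps)" by metis
qed auto

lemma partial_iso_comp:
  assumes P: "partial_iso L M N P" and Q: "partial_iso L N K Q"
  shows "partial_iso L M K (P O Q)"
proof (rule partial_isoI)
  show "a = c \<longleftrightarrow> b = d" if "(a, b) \<in> P O Q" "(c, d) \<in> P O Q" for a b c d
    using that partial_iso_eq[OF P] partial_iso_eq[OF Q] by blast
next
  fix i ps assume ps: "i < length L" "length ps = L ! i" "set ps \<subseteq> P O Q"
  have "\<forall>p\<in>P O Q. \<exists>n. (fst p, n) \<in> P \<and> (n, snd p) \<in> Q" by auto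
  then obtain g where g: "\<And>p. p \<in> P O Q \<Longrightarrow> (fst p, g p) \<in> P \<and> (g p, snd p) \<in> Q"
    by metis
  have "interp M i (map fst (map (\<lambda>p. (fst p, g p)) ps)) =
      interp N i (map snd (map (\<lambda>p. (fst p, g p)) ps))"
    by (rule partial_iso_rel[OF P]) (use ps g in auto)
  moreover have "interp N i (map fst (map (\<lambda>p. (g p, snd p)) ps)) =
      interp K i (map snd (map (\<lambda>p. (g p, snd p)) ps))"
    by (rule partial_iso_rel[OF Q]) (use ps g in auto)
  ultimately show "interp M i (map fst ps) = interp K i (map snd ps)"
    by (simp add: comp_def)
qed

text \<open>
  In \<open>survives L M N m P\<close> the Spoiler makes all of his \<open>m\<close> moves in \<open>M\<close>; in
  \<open>survives_alt L M N m P\<close> he starts in \<open>M\<close> and may switch to \<open>N\<close> once, for good.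
\<close>

primrec survives ::
  "vocabulary \<Rightarrow> 'a fo_struct \<Rightarrow> 'b fo_struct \<Rightarrow> nat \<Rightarrow> ('a \<times> 'b) set \<Rightarrow> bool" where
  "survives L M N 0 P = partial_iso L M N P"
| "survives L M N (Suc m) P =
     (\<forall>a\<in>universe M. \<exists>b\<in>universe N. survives L M N m (insert (a, b) P))"

primrec survives_alt ::
  "vocabulary \<Rightarrow> 'a fo_struct \<Rightarrow> 'b fo_struct \<Rightarrow> nat \<Rightarrow> ('a \<times> 'b) set \<Rightarrow> bool" where
  "survives_alt L M N 0 P = partial_iso L M N P"
| "survives_alt L M N (Suc m) P = (survives L N M (Suc m) (P\<inverse>) \<and>
     (\<forall>a\<in>universe M. \<exists>b\<in>universe N. survives_alt L M N m (insert (a, b) P)))"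

lemma survives_subset: "survives L M N m P \<Longrightarrow> Q \<subseteq> P \<Longrightarrow> survives L M N m Q"
proof (induction m arbitrary: P Q)
  case 0
  then show ?case by (auto intro: partial_iso_subset)
next
  case (Suc m)
  have "survives L M N m (insert (a, b) Q)" if "survives L M N m (insert (a, b) P)" for a b
    using Suc.IH[OF that] Suc.prems(2) by (meson insert_mono)
  with Suc.prems(1) show ?case unfolding survives.simps by blast
qed

text \<open>A Spoiler with a move to spare can waste it on any element, which exists because the
  universe is nonempty; the extra pair is dropped at the end.\<close>

lemma survives_Suc:
  assumes "universe M \<noteq> {}"
  shows "survives L M N (Suc m) P \<Longrightarrow> survives L M N m P"
proof (induction m arbitrary: P)
  case 0
  then obtain a b where "partial_iso L M N (insert (a, b) P)"
    using assms unfolding survives.simps by blast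
  then show ?case by (auto intro: partial_iso_subset)
next
  case (Suc m)
  show ?case
    unfolding survives.simps(2)[of L M N m]
  proof
    fix a assume "a \<in> universe M"
    then obtain b where "b \<in> universe N" "survives L M N (Suc m) (insert (a, b) P)"
      using Suc.prems by auto
    then show "\<exists>b\<in>universe N. survives L M N m (insert (a, b) P)" using Suc.IH by blast
  qed
qed

lemma survives_antimono:
  assumes "universe M \<noteq> {}" "m \<le> m'" "survives L M N m' P"
  shows "survives L M N m P"
  using assms(2,3)
  by (induction rule: dec_induct) (use survives_Suc[OF assms(1)] in blast)+

lemma survives_imp_partial_iso:
  "universe M \<noteq> {} \<Longrightarrow> survives L M N m P \<Longrightarrow> partial_iso L M N P"
  using survives_antimono[of M 0 m L N P] by simp

text \<open>The Spoiler plays the elements of \<open>A\<close> one after another and wastes surplus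
  moves. The upper bound on \<open>Q\<close> records that all new answers are elements of the
  universe of \<open>N\<close>.\<close>

lemma survives_moves:
  assumes "universe M \<noteq> {}" "finite A" "A \<subseteq> universe M" "card A + m \<le> m'" "survives L M N m' P"
  obtains Q where "P \<subseteq> Q" "Q \<subseteq> P \<union> universe M \<times> universe N" "A \<subseteq> Domain Q"
    "survives L M N m Q"
proof -
  have "\<exists>Q. P \<subseteq> Q \<and> Q \<subseteq> P \<union> universe M \<times> universe N \<and> A \<subseteq> Domain Q \<and> survives L M N m Q"
    if "survives L M N (card A + m) P"
    using assms(2,3) that
  proof (induction arbitrary: P)
    case empty
    then show ?case by auto
  next
    case (insert a A)
    then obtain b where b: "b \<in> universe N" "survives L M N (card A + m) (insert (a, b) P)"
      by auto
    obtain Q where "insert (a, b) P \<subseteq> Q" "Q \<subseteq> insert (a, b) P \<union> universe M \<times> universe N"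
      "A \<subseteq> Domain Q" "survives L M N m Q"
      using insert.IH[OF _ b(2)] insert.prems(1) by auto
    then show ?case using b(1) insert.prems(1) by (intro exI[of _ Q]) auto
  qed
  then show thesis using survives_antimono[OF assms(1,4,5)] that by blast
qed

lemma survives_alt_same: "survives_alt L M N m P \<Longrightarrow> survives L M N m P"
  by (induction m arbitrary: P) (simp, force)

lemma survives_alt_switch: "survives_alt L M N m P \<Longrightarrow> survives L N M m (P\<inverse>)"
  by (cases m) auto

lemma survives_alt_Suc:
  assumes "universe M \<noteq> {}" "universe N \<noteq> {}"
  shows "survives_alt L M N (Suc m) P \<Longrightarrow> survives_alt L M N m P"
proof (induction m arbitrary: P)
  case 0
  then obtain a b where "partial_iso L M N (insert (a, b) P)"
    using assms(1) unfolding survives_alt.simps by blast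
  then show ?case by (auto intro: partial_iso_subset)
next
  case (Suc m)
  have "survives L N M (Suc m) (P\<inverse>)"
    using Suc.prems survives_Suc[OF assms(2), of L M "Suc m" "P\<inverse>"] by simp
  moreover have "\<exists>b\<in>universe N. survives_alt L M N m (insert (a, b) P)" if a: "a \<in> universe M" for a
  proof -
    obtain b where "b \<in> universe N" "survives_alt L M N (Suc m) (insert (a, b) P)"
      using Suc.prems a unfolding survives_alt.simps(2)[of L M N "Suc m"] by blast
    then show ?thesis using Suc.IH by blast
  qed
  ultimately show ?case by simp
qed

lemma survives_alt_antimono:
  assumes "universe M \<noteq> {}" "universe N \<noteq> {}" "m \<le> m'" "survives_alt L M N m' P"
  shows "survives_alt L M N m P"
  using assms(3,4)
  by (induction rule: dec_induct) (use survives_alt_Suc[OF assms(1,2)] in blast)+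

lemma survives_alt_moves:
  assumes "universe M \<noteq> {}" "universe N \<noteq> {}" "finite A" "A \<subseteq> universe M" "card A + m \<le> m'"
    "survives_alt L M N m' P"
  obtains Q where "P \<subseteq> Q" "Q \<subseteq> P \<union> universe M \<times> universe N" "A \<subseteq> Domain Q"
    "survives_alt L M N m Q"
proof -
  have "\<exists>Q. P \<subseteq> Q \<and> Q \<subseteq> P \<union> universe M \<times> universe N \<and> A \<subseteq> Domain Q \<and> survives_alt L M N m Q"
    if "survives_alt L M N (card A + m) P"
    using assms(3,4) that
  proof (induction arbitrary: P)
    case empty
    then show ?case by auto
  next
    case (insert a A)
    then obtain b where b: "b \<in> universe N" "survives_alt L M N (card A + m) (insert (a, b) P)"
      by auto
    obtain Q where "insert (a, b) P \<subseteq> Q" "Q \<subseteq> insert (a, b) P \<union> universe M \<times> universe N"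
      "A \<subseteq> Domain Q" "survives_alt L M N m Q"
      using insert.IH[OF _ b(2)] insert.prems(1) by auto
    then show ?case using b(1) insert.prems(1) by (intro exI[of _ Q]) auto
  qed
  then show thesis using survives_alt_antimono[OF assms(1,2,5,6)] that by blast
qed


subsection \<open>Formulas describing the game\<close>

fun conj_list :: "fm list \<Rightarrow> fm" where
  "conj_list [] = Eq 0 0"
| "conj_list [\<phi>] = \<phi>"
| "conj_list (\<phi> # \<psi> # \<phi>s) = And \<phi> (conj_list (\<psi> # \<phi>s))"

text \<open>\<open>Eq 0 0\<close> at the empty list is a placeholder: it is true although an empty
  disjunction is false, so the semantic fact asks for a nonempty list. Nonempty lists get no dummy
  member, which makes free variables and \<open>nest\<close> exact unions.\<close>

fun disj_list :: "fm list \<Rightarrow> fm" where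
  "disj_list [] = Eq 0 0"
| "disj_list [\<phi>] = \<phi>"
| "disj_list (\<phi> # \<psi> # \<phi>s) = Or \<phi> (disj_list (\<psi> # \<phi>s))"

lemma sat_conj_list: "sat M e (conj_list \<phi>s) \<longleftrightarrow> (\<forall>\<phi>\<in>set \<phi>s. sat M e \<phi>)"
  by (induction \<phi>s rule: conj_list.induct) auto

lemma sat_disj_list: "\<phi>s \<noteq> [] \<Longrightarrow> sat M e (disj_list \<phi>s) \<longleftrightarrow> (\<exists>\<phi>\<in>set \<phi>s. sat M e \<phi>)"
  by (induction \<phi>s rule: disj_list.induct) auto

lemma wf_conj_list: "wf_fm L (conj_list \<phi>s) \<longleftrightarrow> (\<forall>\<phi>\<in>set \<phi>s. wf_fm L \<phi>)"
  by (induction \<phi>s rule: conj_list.induct) auto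

lemma wf_disj_list: "wf_fm L (disj_list \<phi>s) \<longleftrightarrow> (\<forall>\<phi>\<in>set \<phi>s. wf_fm L \<phi>)"
  by (induction \<phi>s rule: disj_list.induct) auto

lemma free_vars_conj_list: "\<phi>s \<noteq> [] \<Longrightarrow> free_vars (conj_list \<phi>s) = \<Union> (free_vars ` set \<phi>s)"
  by (induction \<phi>s rule: conj_list.induct) auto

lemma free_vars_disj_list: "\<phi>s \<noteq> [] \<Longrightarrow> free_vars (disj_list \<phi>s) = \<Union> (free_vars ` set \<phi>s)"
  by (induction \<phi>s rule: disj_list.induct) auto

lemma nest_conj_list: "\<phi>s \<noteq> [] \<Longrightarrow> nest (conj_list \<phi>s) = \<Union> (nest ` set \<phi>s)"
  by (induction \<phi>s rule: conj_list.induct) auto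

lemma nest_disj_list: "\<phi>s \<noteq> [] \<Longrightarrow> nest (disj_list \<phi>s) = \<Union> (nest ` set \<phi>s)"
  by (induction \<phi>s rule: disj_list.induct) auto

definition literal :: "bool \<Rightarrow> fm \<Rightarrow> fm" where
  "literal b \<phi> = (if b then \<phi> else Neg \<phi>)"

text \<open>The variable \<open>p\<close> names the entry \<open>as ! p\<close>. The literals run
  over indices, so repetitions in \<open>as\<close> are recorded by the equalities.\<close>

definition diagram_list :: "vocabulary \<Rightarrow> 'a fo_struct \<Rightarrow> 'a list \<Rightarrow> fm list" where
  "diagram_list L M as =
     [literal (as ! p = as ! q) (Eq p q). p \<leftarrow> [0..<length as], q \<leftarrow> [0..<length as]] @
     [literal (interp M i (map ((!) as) js)) (Rel i js).
        i \<leftarrow> [0..<length L], js \<leftarrow> List.n_lists (L ! i) [0..<length as]]"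

definition diagram :: "vocabulary \<Rightarrow> 'a fo_struct \<Rightarrow> 'a list \<Rightarrow> fm" where
  "diagram L M as = And (Eq 0 0) (conj_list (diagram_list L M as))"

lemma set_diagram_list: "set (diagram_list L M as) =
    {literal (as ! p = as ! q) (Eq p q) | p q. p < length as \<and> q < length as} \<union>
    {literal (interp M i (map ((!) as) js)) (Rel i js) | i js.
       i < length L \<and> length js = L ! i \<and> set js \<subseteq> {..<length as}}"
  unfolding diagram_list_def by (auto simp: set_n_lists) (force, force)

lemma sat_diagram: "sat N e (diagram L M as) \<longleftrightarrow>
    partial_iso L M N (set (zip as (map e [0..<length as])))"
proof -
  let ?n = "length as"
  let ?P = "set (zip as (map e [0..<?n]))"
  let ?f = "\<lambda>p. (as ! p, e p)"
  have P: "?P = ?f ` {..<?n}"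
    by (auto simp: set_zip image_iff)
  have "sat N e (diagram L M as) \<longleftrightarrow>
    (\<forall>p<?n. \<forall>q<?n. as ! p = as ! q \<longleftrightarrow> e p = e q) \<and>
    (\<forall>i<length L. \<forall>js. length js = L ! i \<and> set js \<subseteq> {..<?n} \<longrightarrow>
       interp M i (map ((!) as) js) = interp N i (map e js))"
  proof -
    have lit: "sat N e (literal b \<phi>) \<longleftrightarrow> (b \<longleftrightarrow> sat N e \<phi>)" for b \<phi>
      by (simp add: literal_def)
    have ball: "(\<forall>z\<in>{g x y | x y. A x y}. B z) \<longleftrightarrow> (\<forall>x y. A x y \<longrightarrow> B (g x y))"
      for A B and g :: "'c \<Rightarrow> 'd \<Rightarrow> fm"
      by blast
    show ?thesis
      unfolding diagram_def sat.simps sat_conj_list set_diagram_list ball_Un ball lit by blast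
  qed
  also have "\<dots> \<longleftrightarrow> partial_iso L M N ?P"
  proof -
    have "(\<forall>js. length js = l \<and> set js \<subseteq> {..<?n} \<longrightarrow>
            interp M i (map ((!) as) js) = interp N i (map e js)) \<longleftrightarrow>
          (\<forall>ps. length ps = l \<and> set ps \<subseteq> ?P \<longrightarrow>
            interp M i (map fst ps) = interp N i (map snd ps))" (is "?l = ?r") for i l
    proof
      assume ?l
      show ?r
      proof (intro allI impI, elim conjE)
        fix ps assume ps: "length ps = l" "set ps \<subseteq> ?P"
        then have "ps \<in> lists (?f ` {..<?n})" by (auto simp: P)
        then obtain js where "js \<in> lists {..<?n}" "ps = map ?f js"
          by (auto simp: lists_image)
        then show "interp M i (map fst ps) = interp N i (map snd ps)"
          using \<open>?l\<close> ps by (auto simp: comp_def in_lists_conv_set)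
      qed
    next
      assume ?r
      show ?l
      proof (intro allI impI, elim conjE)
        fix js assume js: "length js = l" "set js \<subseteq> {..<?n}"
        then have "length (map ?f js) = l \<and> set (map ?f js) \<subseteq> ?P" by (auto simp: P)
        then have "interp M i (map fst (map ?f js)) = interp N i (map snd (map ?f js))"
          using \<open>?r\<close> by blast
        then show "interp M i (map ((!) as) js) = interp N i (map e js)"
          by (simp add: comp_def)
      qed
    qed
    then show ?thesis unfolding partial_iso_def by (auto simp: P)
  qed
  finally show ?thesis .
qed

lemma wf_diagram: "wf_fm L (diagram L M as)"
  unfolding diagram_def wf_fm.simps wf_conj_list set_diagram_list by (auto simp: literal_def)

lemma free_vars_diagram: "as \<noteq> [] \<Longrightarrow> free_vars (diagram L M as) \<subseteq> {..<length as}"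
proof -
  assume as: "as \<noteq> []"
  have "free_vars \<phi> \<subseteq> {..<length as}" if "\<phi> \<in> set (diagram_list L M as)" for \<phi>
    using that unfolding set_diagram_list by (auto simp: literal_def split: if_splits)
  then show ?thesis
    using as unfolding diagram_def
    by (cases "diagram_list L M as = []") (auto simp: free_vars_conj_list)
qed

lemma nest_diagram: "nest (diagram L M as) = {[]}"
proof -
  have "nest \<phi> = {[]}" if "\<phi> \<in> set (diagram_list L M as)" for \<phi>
    using that unfolding set_diagram_list by (auto simp: literal_def split: if_splits)
  then show ?thesis
    unfolding diagram_def
    by (cases "diagram_list L M as = []") (auto simp: nest_conj_list)
qed

section \<open>Hintikka formulas of the games\<close>

context
  fixes L :: vocabulary and M :: "'a fo_struct" and vs :: "'a list"
begin

text \<open>The four formulas are Hintikka formulas: \<open>as\<close> lists the elements of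
  \<open>M\<close> in play, \<open>length as\<close> is the next fresh variable, and
  \<open>vs\<close> will enumerate the universe of \<open>M\<close>. A move in \<open>M\<close>
  becomes a conjunction of existential formulas, a move in the other structure a universal
  quantifier over a disjunction. The mixed formulas have as an extra conjunct the pure formula of
  the same rank, for a Spoiler who switches now.\<close>

primrec ex_fm :: "nat \<Rightarrow> 'a list \<Rightarrow> fm" where
  "ex_fm 0 as = diagram L M as"
| "ex_fm (Suc m) as = conj_list (map (\<lambda>a. Exists (length as) (ex_fm m (as @ [a]))) vs)"

primrec all_fm :: "nat \<Rightarrow> 'a list \<Rightarrow> fm" where
  "all_fm 0 as = diagram L M as"
| "all_fm (Suc m) as = Forall (length as) (disj_list (map (\<lambda>a. all_fm m (as @ [a])) vs))"

primrec ex_all_fm :: "nat \<Rightarrow> 'a list \<Rightarrow> fm" where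
  "ex_all_fm 0 as = diagram L M as"
| "ex_all_fm (Suc m) as = And (all_fm (Suc m) as)
     (conj_list (map (\<lambda>a. Exists (length as) (ex_all_fm m (as @ [a]))) vs))"

primrec all_ex_fm :: "nat \<Rightarrow> 'a list \<Rightarrow> fm" where
  "all_ex_fm 0 as = diagram L M as"
| "all_ex_fm (Suc m) as = And (ex_fm (Suc m) as)
     (Forall (length as) (disj_list (map (\<lambda>a. all_ex_fm m (as @ [a])) vs)))"

lemma wf_game_fm:
  "wf_fm L (ex_fm m as)" "wf_fm L (all_fm m as)" "wf_fm L (ex_all_fm m as)" "wf_fm L (all_ex_fm m as)"
proof -
  show 1: "wf_fm L (ex_fm m as)" for m as
    by (induction m arbitrary: as) (auto simp: wf_diagram wf_conj_list)
  show 2: "wf_fm L (all_fm m as)" for m as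
    by (induction m arbitrary: as) (auto simp: wf_diagram wf_disj_list)
  show "wf_fm L (ex_all_fm m as)"
    by (induction m arbitrary: as)
      (auto simp: wf_diagram wf_conj_list 2 simp del: all_fm.simps(2))
  show "wf_fm L (all_ex_fm m as)"
    by (induction m arbitrary: as)
      (auto simp: wf_diagram wf_disj_list 1 simp del: ex_fm.simps(2))
qed

context
  assumes vs: "vs \<noteq> []"
begin

text \<open>With no move left and nothing in play the diagram still mentions the variable 0 through
  \<open>Eq 0 0\<close>; the assumption excludes exactly this case.\<close>

lemma free_vars_game_fm:
  assumes "m + length as > 0"
  shows "free_vars (ex_fm m as) \<subseteq> {..<length as}" "free_vars (all_fm m as) \<subseteq> {..<length as}"
    "free_vars (ex_all_fm m as) \<subseteq> {..<length as}" "free_vars (all_ex_fm m as) \<subseteq> {..<length as}"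
proof -
  have *: "A - {length as} \<subseteq> {..<length as}" if "A \<subseteq> {..<length (as @ [a])}" for A as and a :: 'a
    using that by (auto simp: less_Suc_eq)
  have 1: "free_vars (ex_fm m as) \<subseteq> {..<length as}" if "m + length as > 0" for m as
    using that
  proof (induction m arbitrary: as)
    case (Suc m)
    have "free_vars (ex_fm m (as @ [a])) - {length as} \<subseteq> {..<length as}" for a
      by (rule *[OF Suc.IH]) simp
    then show ?case using vs by (auto simp: free_vars_conj_list)
  qed (simp add: free_vars_diagram)
  have 2: "free_vars (all_fm m as) \<subseteq> {..<length as}" if "m + length as > 0" for m as
    using that
  proof (induction m arbitrary: as)
    case (Suc m)
    have "free_vars (all_fm m (as @ [a])) - {length as} \<subseteq> {..<length as}" for a
      by (rule *[OF Suc.IH]) simp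
    then show ?case using vs by (auto simp: free_vars_disj_list)
  qed (simp add: free_vars_diagram)
  show "free_vars (ex_fm m as) \<subseteq> {..<length as}" "free_vars (all_fm m as) \<subseteq> {..<length as}"
    by (rule 1[OF assms], rule 2[OF assms])
  show "free_vars (ex_all_fm m as) \<subseteq> {..<length as}"
    using assms
  proof (induction m arbitrary: as)
    case (Suc m)
    have "free_vars (ex_all_fm m (as @ [a])) - {length as} \<subseteq> {..<length as}" for a
      by (rule *[OF Suc.IH]) simp
    then show ?case using vs 2[of "Suc m" as] by (auto simp: free_vars_conj_list)
  qed (simp add: free_vars_diagram)
  show "free_vars (all_ex_fm m as) \<subseteq> {..<length as}"
    using assms
  proof (induction m arbitrary: as)
    case (Suc m)
    have "free_vars (all_ex_fm m (as @ [a])) - {length as} \<subseteq> {..<length as}" for a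
      by (rule *[OF Suc.IH]) simp
    then show ?case using vs 1[of "Suc m" as] by (auto simp: free_vars_disj_list)
  qed (simp add: free_vars_diagram)
qed

lemma nest_ex_fm: "nest (ex_fm m as) = {replicate m QEx}"
  using vs by (induction m arbitrary: as) (auto simp: nest_diagram nest_conj_list)

lemma nest_all_fm: "nest (all_fm m as) = {replicate m QAll}"
  using vs by (induction m arbitrary: as) (auto simp: nest_diagram nest_disj_list)

text \<open>\<open>i\<close> counts the moves made before the switch. All words have length
  \<open>m\<close> and consist of two blocks, which yields both the quantifier rank and the single
  alternation.\<close>

lemma nest_ex_all_fm:
  "nest (ex_all_fm m as) \<subseteq> {replicate i QEx @ replicate (m - i) QAll | i. i \<le> m}"
proof (induction m arbitrary: as)
  case (Suc m)
  have "QEx # w \<in> {replicate i QEx @ replicate (Suc m - i) QAll | i. i \<le> Suc m}"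
    if w: "w \<in> nest (ex_all_fm m (as @ [a]))" for w a
  proof -
    obtain i where "i \<le> m" "w = replicate i QEx @ replicate (m - i) QAll"
      using subsetD[OF Suc.IH w] by auto
    then show ?thesis by (intro CollectI exI[of _ "Suc i"]) auto
  qed
  moreover have "nest (all_fm (Suc m) as) \<subseteq> {replicate i QEx @ replicate (Suc m - i) QAll | i. i \<le> Suc m}"
    unfolding nest_all_fm by (auto intro!: exI[of _ 0])
  ultimately show ?case using vs by (auto simp: nest_conj_list simp del: all_fm.simps(2))
qed (simp add: nest_diagram)

lemma nest_all_ex_fm:
  "nest (all_ex_fm m as) \<subseteq> {replicate i QAll @ replicate (m - i) QEx | i. i \<le> m}"
proof (induction m arbitrary: as)
  case (Suc m)
  have "QAll # w \<in> {replicate i QAll @ replicate (Suc m - i) QEx | i. i \<le> Suc m}"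
    if w: "w \<in> nest (all_ex_fm m (as @ [a]))" for w a
  proof -
    obtain i where "i \<le> m" "w = replicate i QAll @ replicate (m - i) QEx"
      using subsetD[OF Suc.IH w] by auto
    then show ?thesis by (intro CollectI exI[of _ "Suc i"]) auto
  qed
  moreover have "nest (ex_fm (Suc m) as) \<subseteq> {replicate i QAll @ replicate (Suc m - i) QEx | i. i \<le> Suc m}"
    unfolding nest_ex_fm by (auto intro!: exI[of _ 0])
  ultimately show ?case using vs by (auto simp: nest_disj_list simp del: ex_fm.simps(2))
qed (simp add: nest_diagram)

context
  assumes set_vs: "set vs = universe M"
begin

text \<open>On \<open>M\<close> itself the Duplicator copies each move: variable \<open>p\<close>
  has the value \<open>as ! p\<close>, so every \<open>a\<close> is its own witness and satisfies
  its own disjunct.\<close>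

lemma sat_game_fm_self:
  assumes "map e [0..<length as] = as"
  shows "sat M e (ex_fm m as)" "sat M e (all_fm m as)" "sat M e (ex_all_fm m as)"
    "sat M e (all_ex_fm m as)"
proof -
  have diag: "sat M e (diagram L M as)" if "map e [0..<length as] = as" for e as
  proof -
    have "set (zip as as) = Id_on (set as)" by (auto simp: zip_same_conv_map Id_on_def)
    then show ?thesis unfolding sat_diagram that by (simp add: partial_iso_Id_on)
  qed
  have upd: "map (e(length as := a)) [0..<length (as @ [a])] = as @ [a]"
    if "map e [0..<length as] = as" for e as a
  proof -
    have "map (e(length as := a)) [0..<length as] = map e [0..<length as]" by simp
    with that show ?thesis by simp
  qed
  have 1: "sat M e (ex_fm m as)" if "map e [0..<length as] = as" for m e as
    using that
  proof (induction m arbitrary: e as)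
    case (Suc m)
    have "\<forall>a\<in>universe M. sat M (e(length as := a)) (ex_fm m (as @ [a]))"
      using Suc.IH[OF upd[OF Suc.prems]] by blast
    then show ?case using set_vs by (auto simp: sat_conj_list)
  qed (simp add: diag)
  have 2: "sat M e (all_fm m as)" if "map e [0..<length as] = as" for m e as
    using that
  proof (induction m arbitrary: e as)
    case (Suc m)
    have "\<forall>a\<in>universe M. sat M (e(length as := a)) (all_fm m (as @ [a]))"
      using Suc.IH[OF upd[OF Suc.prems]] by blast
    then show ?case using set_vs vs by (auto simp: sat_disj_list)
  qed (simp add: diag)
  show "sat M e (ex_fm m as)" "sat M e (all_fm m as)"
    by (rule 1[OF assms], rule 2[OF assms])
  show "sat M e (ex_all_fm m as)"
    using assms
  proof (induction m arbitrary: e as)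
    case (Suc m)
    have "\<forall>a\<in>universe M. sat M (e(length as := a)) (ex_all_fm m (as @ [a]))"
      using Suc.IH[OF upd[OF Suc.prems]] by blast
    then show ?case using set_vs 2[OF Suc.prems, of "Suc m"] by (auto simp: sat_conj_list simp del: all_fm.simps(2))
  qed (simp add: diag)
  show "sat M e (all_ex_fm m as)"
    using assms
  proof (induction m arbitrary: e as)
    case (Suc m)
    have "\<forall>a\<in>universe M. sat M (e(length as := a)) (all_ex_fm m (as @ [a]))"
      using Suc.IH[OF upd[OF Suc.prems]] by blast
    then show ?case using set_vs vs 1[OF Suc.prems, of "Suc m"] by (auto simp: sat_disj_list simp del: ex_fm.simps(2))
  qed (simp add: diag)
qed

text \<open>Quantifiers are read as moves. The existential conjunct for \<open>a\<close> supplies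
  the answer in \<open>N\<close> to the move \<open>a\<close>; the true disjunct under a universal
  quantifier supplies the answer in \<open>M\<close>. At depth 0 the diagram says that the played
  pairs form a partial isomorphism.\<close>

lemma survives_if_sat:
  fixes N :: "'b fo_struct"
  defines "P \<equiv> \<lambda>e as. set (zip as (map e [0..<length as]))"
  shows "sat N e (ex_fm m as) \<Longrightarrow> survives L M N m (P e as)"
    and "sat N e (all_fm m as) \<Longrightarrow> survives L N M m ((P e as)\<inverse>)"
    and "sat N e (ex_all_fm m as) \<Longrightarrow> survives_alt L M N m (P e as)"
    and "sat N e (all_ex_fm m as) \<Longrightarrow> survives_alt L N M m ((P e as)\<inverse>)"
proof -
  have upd: "P (e(length as := b)) (as @ [a]) = insert (a, b) (P e as)" for e as a and b :: 'b
  proof -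
    have "map (e(length as := b)) [0..<length as] = map e [0..<length as]" by simp
    then show ?thesis unfolding P_def by simp
  qed
  have updc: "(P (e(length as := b)) (as @ [a]))\<inverse> = insert (b, a) ((P e as)\<inverse>)" for e as a and b :: 'b
    unfolding upd by auto
  show 1: "survives L M N m (P e as)" if "sat N e (ex_fm m as)" for m e as
    using that
  proof (induction m arbitrary: e as)
    case (Suc m)
    show ?case
      unfolding survives.simps
    proof
      fix a assume "a \<in> universe M"
      then obtain b where "b \<in> universe N" "sat N (e(length as := b)) (ex_fm m (as @ [a]))"
        using Suc.prems set_vs by (auto simp: sat_conj_list)
      then show "\<exists>b\<in>universe N. survives L M N m (insert (a, b) (P e as))"
        using Suc.IH upd by metis
    qed
  qed (simp add: sat_diagram P_def)
  show 2: "survives L N M m ((P e as)\<inverse>)" if "sat N e (all_fm m as)" for m e as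
    using that
  proof (induction m arbitrary: e as)
    case (Suc m)
    show ?case
      unfolding survives.simps
    proof
      fix b assume "b \<in> universe N"
      then obtain a where "a \<in> universe M" "sat N (e(length as := b)) (all_fm m (as @ [a]))"
        using Suc.prems set_vs vs by (auto simp: sat_disj_list)
      then show "\<exists>a\<in>universe M. survives L N M m (insert (b, a) ((P e as)\<inverse>))"
        using Suc.IH updc by metis
    qed
  qed (simp add: sat_diagram P_def)
  show "sat N e (ex_all_fm m as) \<Longrightarrow> survives_alt L M N m (P e as)"
  proof (induction m arbitrary: e as)
    case (Suc m)
    have "survives L N M (Suc m) ((P e as)\<inverse>)" by (rule 2) (use Suc.prems in simp)
    moreover have "\<exists>b\<in>universe N. survives_alt L M N m (insert (a, b) (P e as))"
      if a: "a \<in> universe M" for a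
    proof -
      have "sat N e (conj_list (map (\<lambda>a. Exists (length as) (ex_all_fm m (as @ [a]))) vs))"
        using Suc.prems by simp
      then obtain b where "b \<in> universe N" "sat N (e(length as := b)) (ex_all_fm m (as @ [a]))"
        using set_vs a by (auto simp: sat_conj_list)
      then show ?thesis using Suc.IH upd by metis
    qed
    ultimately show ?case by simp
  qed (simp add: sat_diagram P_def)
  show "sat N e (all_ex_fm m as) \<Longrightarrow> survives_alt L N M m ((P e as)\<inverse>)"
  proof (induction m arbitrary: e as)
    case (Suc m)
    have "survives L M N (Suc m) (((P e as)\<inverse>)\<inverse>)"
      unfolding converse_converse by (rule 1) (use Suc.prems in simp)
    moreover have "\<exists>a\<in>universe M. survives_alt L N M m (insert (b, a) ((P e as)\<inverse>))"
      if "b \<in> universe N" for b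
    proof -
      have "sat N (e(length as := b)) (disj_list (map (\<lambda>a. all_ex_fm m (as @ [a])) vs))"
        using Suc.prems that by simp
      then obtain a where "a \<in> universe M" "sat N (e(length as := b)) (all_ex_fm m (as @ [a]))"
        using set_vs vs by (auto simp: sat_disj_list)
      then show ?thesis using Suc.IH updc by metis
    qed
    ultimately show ?case unfolding survives_alt.simps by blast
  qed (simp add: sat_diagram P_def)
qed

end

end

end

text \<open>Letters can change only at the seam, between positions \<open>i - 1\<close> and
  \<open>i\<close>.\<close>

lemma alternations_two_blocks: "alternations (replicate i x @ replicate j y) \<le> 1"
proof -
  have "{p. Suc p < length (replicate i x @ replicate j y) \<and>
      (replicate i x @ replicate j y) ! p \<noteq> (replicate i x @ replicate j y) ! Suc p} \<subseteq> {i - 1}"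
    by (auto simp: nth_append split: if_splits)
  from card_mono[OF _ this] show ?thesis unfolding alternations_def by simp
qed

text \<open>The defining formula is the conjunction of the two mixed formulas, one for each
  structure in which the Spoiler may start. Every word of its \<open>nest\<close> has length
  \<open>r\<close>, and \<open>0 < r\<close> makes it closed.\<close>

lemma D1_le:
  fixes M :: "'a fo_struct"
  assumes M: "finite_struct M" and r: "0 < r"
    and iso: "\<And>N :: nat fo_struct. finite_struct N \<Longrightarrow> survives_alt L M N r {} \<Longrightarrow>
      survives_alt L N M r {} \<Longrightarrow> isomorphic L M N"
  shows "D1 L M \<le> enat r"
proof -
  obtain vs where vs: "set vs = universe M" "vs \<noteq> []"
    using M finite_list unfolding finite_struct_def by (metis set_empty)
  define \<phi> where "\<phi> = And (ex_all_fm L M vs r []) (all_ex_fm L M vs r [])"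
  have nest: "nest \<phi> \<subseteq> {replicate i QEx @ replicate (r - i) QAll | i. i \<le> r} \<union>
      {replicate i QAll @ replicate (r - i) QEx | i. i \<le> r}"
    using nest_ex_all_fm[OF vs(2), of L M r "[]"] nest_all_ex_fm[OF vs(2), of L M r "[]"]
    by (simp add: \<phi>_def) blast
  have "defines_struct L \<phi> M"
    unfolding defines_struct_def
  proof (intro conjI allI impI)
    show "wf_fm L \<phi>" by (simp add: \<phi>_def wf_game_fm)
    show "closed_fm \<phi>"
      using free_vars_game_fm(3,4)[OF vs(2), of r "[]" L M] r by (simp add: closed_fm_def \<phi>_def)
    show "true_on M \<phi>"
      unfolding true_on_def \<phi>_def
      using sat_game_fm_self(3,4)[OF vs(2,1), where as = "[]"] by simp
    fix N :: "nat fo_struct"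
    assume N: "finite_struct N \<and> \<not> isomorphic L M N"
    show "\<not> true_on N \<phi>"
    proof
      assume "true_on N \<phi>"
      moreover obtain x where "x \<in> universe N" using N by (auto simp: finite_struct_def)
      ultimately have "sat N (\<lambda>_. x) \<phi>" by (auto simp: true_on_def)
      then have "survives_alt L M N r {}" "survives_alt L N M r {}"
        using survives_if_sat(3,4)[OF vs(2,1), of N "\<lambda>_. x" L r "[]"] by (simp_all add: \<phi>_def)
      with iso N show False by blast
    qed
  qed
  moreover have "alternation_number \<phi> \<le> 1"
  proof -
    have "alternations w \<le> 1" if "w \<in> nest \<phi>" for w
      using subsetD[OF nest that] alternations_two_blocks by blast
    then show ?thesis
      unfolding alternation_number_def by (simp add: finite_nest nest_nonempty)
  qed
  moreover have "quantifier_rank \<phi> = r"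
  proof -
    have "length w = r" if "w \<in> nest \<phi>" for w using subsetD[OF nest that] by auto
    then have "length ` nest \<phi> = {r}" using nest_nonempty[of \<phi>] by auto
    then show ?thesis by (simp add: quantifier_rank_def)
  qed
  ultimately show ?thesis unfolding D1_def by (metis (mono_tags, lifting) INF_lower mem_Collect_eq)
qed


subsection \<open>Types over a set and saturation\<close>

lemma quotient_coarsen:
  assumes "equiv A r" "equiv B s" "B \<subseteq> A" "s \<subseteq> r" "b \<in> B"
  shows "r `` (s `` {b}) = r `` {b}"
proof -
  have "(b, b) \<in> s" using assms(2,5) by (auto simp: equiv_def refl_on_def)
  moreover have "trans r" "sym r" using assms(1) by (auto simp: equiv_def)
  ultimately show ?thesis using assms(4) by (blast dest: transD symD)
qed

lemma coarsen_quotient_subset: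
  assumes "equiv A r" "equiv B s" "B \<subseteq> A" "s \<subseteq> r"
  shows "(\<lambda>K. r `` K) ` (B // s) \<subseteq> A // r"
proof
  fix K assume "K \<in> (\<lambda>K. r `` K) ` (B // s)"
  then obtain b where "b \<in> B" "K = r `` (s `` {b})" by (auto elim!: quotientE)
  then show "K \<in> A // r" using quotient_coarsen[OF assms] assms(3) by (auto intro: quotientI)
qed

text \<open>Send each class of \<open>s\<close> to the class of \<open>r\<close> that contains it.
  This map is onto when \<open>B\<close> meets every class of \<open>r\<close>, and not injective
  once \<open>s\<close> splits a class of \<open>r\<close> within \<open>B\<close>; it is injective
  when \<open>s\<close> agrees with \<open>r\<close> on \<open>B\<close>. These observations give
  the three counts that start here.\<close>

lemma card_quotient_le:
  assumes e: "equiv A r" "equiv B s" "B \<subseteq> A" "s \<subseteq> r" and "finite A"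
    and meets: "\<And>a. a \<in> A \<Longrightarrow> \<exists>b\<in>B. (a, b) \<in> r"
  shows "card (A // r) \<le> card ((\<lambda>K. r `` K) ` (B // s))"
proof (rule card_mono)
  show "A // r \<subseteq> (\<lambda>K. r `` K) ` (B // s)"
  proof
    fix K assume "K \<in> A // r"
    then obtain a where a: "a \<in> A" "K = r `` {a}" by (auto elim!: quotientE)
    obtain b where b: "b \<in> B" "(a, b) \<in> r" using meets a by blast
    then have "K = r `` {b}" using a equiv_class_eq[OF e(1)] by blast
    then have "K = r `` (s `` {b})" using quotient_coarsen[OF e b(1)] by simp
    then show "K \<in> (\<lambda>K. r `` K) ` (B // s)" using b(1) by (auto intro: quotientI)
  qed
  show "finite ((\<lambda>K. r `` K) ` (B // s))"
    using finite_subset[OF e(3) assms(5)] e(2) by (auto simp: finite_quotient equiv_def)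
qed

lemma card_quotient_less:
  assumes e: "equiv A r" "equiv B s" "B \<subseteq> A" "s \<subseteq> r" and "finite A"
    and meets: "\<And>a. a \<in> A \<Longrightarrow> \<exists>b\<in>B. (a, b) \<in> r"
    and split: "a \<in> B" "b \<in> B" "(a, b) \<in> r" "(a, b) \<notin> s"
  shows "card (A // r) < card (B // s)"
proof -
  have fin: "finite (B // s)"
    using finite_subset[OF e(3) assms(5)] e(2) by (auto simp: finite_quotient equiv_def)
  have "\<not> inj_on (\<lambda>K. r `` K) (B // s)"
  proof
    assume "inj_on (\<lambda>K. r `` K) (B // s)"
    moreover have "r `` (s `` {a}) = r `` (s `` {b})"
      using quotient_coarsen[OF e] split equiv_class_eq[OF e(1)] by simp
    ultimately have "s `` {a} = s `` {b}" using split(1,2) by (meson inj_onD quotientI)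
    then show False using eq_equiv_class[OF _ e(2) split(2)] split(4) by blast
  qed
  then have "card ((\<lambda>K. r `` K) ` (B // s)) < card (B // s)"
    using fin by (meson card_image_le eq_card_imp_inj_on le_neq_implies_less)
  with card_quotient_le[OF e assms(5) meets] show ?thesis by simp
qed

lemma card_quotient_restrict:
  assumes e: "equiv A r" "equiv B s" "B \<subseteq> A" "s \<subseteq> r" and "finite A"
    and restr: "\<And>a b. a \<in> B \<Longrightarrow> b \<in> B \<Longrightarrow> (a, b) \<in> r \<Longrightarrow> (a, b) \<in> s"
  shows "card (B // s) \<le> card (A // r)"
proof (rule card_inj_on_le)
  show "inj_on (\<lambda>K. r `` K) (B // s)"
  proof (rule inj_onI)
    fix K K' assume "K \<in> B // s" "K' \<in> B // s" and eq: "r `` K = r `` K'"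
    then obtain a b where ab: "a \<in> B" "K = s `` {a}" "b \<in> B" "K' = s `` {b}"
      by (auto elim!: quotientE)
    then have "r `` {a} = r `` {b}" using eq quotient_coarsen[OF e] by simp
    then have "(a, b) \<in> r" using eq_equiv_class[OF _ e(1)] ab e(3) by blast
    then show "K = K'" using restr ab equiv_class_eq[OF e(2)] by simp
  qed
  show "(\<lambda>K. r `` K) ` (B // s) \<subseteq> A // r" by (rule coarsen_quotient_subset[OF e])
  show "finite (A // r)" using assms(5) e(1) by (auto simp: finite_quotient equiv_def)
qed

section \<open>Similarity and relations on tuples\<close>

lemma similar_rel:
  assumes "(a, b) \<in> similar L M" "i < length L" "length xs = L ! i" "set xs \<subseteq> universe M"
  shows "interp M i (map (transpose a b) xs) = interp M i xs"
  using assms by (auto simp: similar_def automorphism_def isomorphism_def)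

lemma similarI:
  assumes "a \<in> universe M" "b \<in> universe M"
    and "\<And>i xs. i < length L \<Longrightarrow> length xs = L ! i \<Longrightarrow> set xs \<subseteq> universe M \<Longrightarrow>
      interp M i xs = interp M i (map (transpose a b) xs)"
  shows "(a, b) \<in> similar L M"
proof -
  have "bij_betw (transpose a b) (universe M) (universe M)"
    using assms(1,2) by (intro bij_betw_byWitness[where f' = "transpose a b"]) (auto simp: transpose_def)
  with assms show ?thesis by (auto simp: similar_def automorphism_def isomorphism_def)
qed

text \<open>Following \<open>\<phi>\<close> by the transposition of \<open>a\<close> and
  \<open>\<phi> a\<close> returns \<open>a\<close> to itself, moves no new point by injectivity, and
  applies an automorphism. Induction on the number of moved points undoes \<open>\<phi>\<close>
  altogether.\<close>

lemma similar_image_rel: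
  fixes M :: "'a fo_struct"
  assumes "finite A" "A \<subseteq> universe M" "inj_on \<phi> A" "\<And>a. a \<in> A \<Longrightarrow> (a, \<phi> a) \<in> similar L M"
    and "i < length L" "length xs = L ! i" "set xs \<subseteq> A"
  shows "interp M i (map \<phi> xs) = interp M i xs"
  using assms(3,4)
proof (induction "card {a\<in>A. \<phi> a \<noteq> a}" arbitrary: \<phi> rule: less_induct)
  case less
  show ?case
  proof (cases "\<exists>a\<in>A. \<phi> a \<noteq> a")
    case False
    then have "map \<phi> xs = xs" using assms(7) by (auto intro!: map_idI)
    then show ?thesis by simp
  next
    case True
    then obtain a where a: "a \<in> A" "\<phi> a \<noteq> a" by blast
    define \<psi> where "\<psi> = transpose a (\<phi> a) \<circ> \<phi>"
    have sub: "{x\<in>A. \<psi> x \<noteq> x} \<subseteq> {x\<in>A. \<phi> x \<noteq> x} - {a}"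
    proof
      fix x assume "x \<in> {x\<in>A. \<psi> x \<noteq> x}"
      then have x: "x \<in> A" "\<psi> x \<noteq> x" by auto
      have "x \<noteq> a" using x by (auto simp: \<psi>_def)
      moreover have "\<phi> x \<noteq> x"
      proof
        assume "\<phi> x = x"
        moreover have "\<phi> x \<noteq> \<phi> a" using inj_onD[OF less.prems(1)] x a \<open>x \<noteq> a\<close> by blast
        ultimately have "\<psi> x = x" using \<open>x \<noteq> a\<close> by (simp add: \<psi>_def transpose_def)
        with x show False by simp
      qed
      ultimately show "x \<in> {x\<in>A. \<phi> x \<noteq> x} - {a}" using x by simp
    qed
    have "card {x\<in>A. \<psi> x \<noteq> x} < card {x\<in>A. \<phi> x \<noteq> x}"
      using sub a assms(1) by (intro psubset_card_mono) auto
    moreover have "inj_on \<psi> A"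
      unfolding \<psi>_def using less.prems(1) by (intro comp_inj_on) (auto intro: inj_on_subset[OF inj_transpose])
    moreover have "(x, \<psi> x) \<in> similar L M" if "x \<in> A" for x
    proof -
      have eq: "equiv (universe M) (similar L M)" by (rule equiv_similar)
      have "(x, \<phi> x) \<in> similar L M" "(a, \<phi> a) \<in> similar L M" using less.prems(2) that a by auto
      then show ?thesis
        unfolding \<psi>_def comp_def transpose_def
        using eq by (auto simp: equiv_def dest: symD transD)
    qed
    ultimately have "interp M i (map \<psi> xs) = interp M i xs" by (rule less.hyps)
    moreover have "interp M i (map (transpose a (\<phi> a)) (map \<phi> xs)) = interp M i (map \<phi> xs)"
    proof (rule similar_rel)
      show "(a, \<phi> a) \<in> similar L M" using less.prems(2) a by auto
      show "set (map \<phi> xs) \<subseteq> universe M"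
        using less.prems(2) assms(7) by (auto simp: similar_def)
    qed (use assms in auto)
    ultimately show ?thesis by (simp add: \<psi>_def)
  qed
qed

section \<open>Types over a set of elements\<close>

locale bounded_arity_struct =
  fixes L :: vocabulary and M :: "'a fo_struct" and k :: nat
  assumes finite_universe: "finite (universe M)"
    and arity_le: "\<And>i. i < length L \<Longrightarrow> L ! i \<le> k"
    and k_pos: "0 < k"
begin

abbreviation V where "V \<equiv> universe M"

definition same_type :: "'a set \<Rightarrow> ('a \<times> 'a) set" where
  "same_type D =
     {(a, b). a \<in> V - D \<and> b \<in> V - D \<and> partial_iso L M M (insert (a, b) (Id_on D))}"

definition num_types :: "'a set \<Rightarrow> nat" where
  "num_types D = card ((V - D) // same_type D)"

text \<open>A tuple over \<open>insert a D\<close> does not contain \<open>b\<close> unless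
  \<open>a = b\<close>, so on it the transposition is the map that fixes \<open>D\<close> and sends
  \<open>a\<close> to \<open>b\<close>. In this form types compare directly with similarity, which
  is the same condition for all tuples.\<close>

lemma same_type_iff:
  "(a, b) \<in> same_type D \<longleftrightarrow> a \<in> V - D \<and> b \<in> V - D \<and>
     (\<forall>i<length L. \<forall>xs. length xs = L ! i \<and> set xs \<subseteq> insert a D \<longrightarrow>
        interp M i xs = interp M i (map (transpose a b) xs))"
proof -
  have "partial_iso L M M (insert (a, b) (Id_on D)) \<longleftrightarrow>
     (\<forall>i<length L. \<forall>xs. length xs = L ! i \<and> set xs \<subseteq> insert a D \<longrightarrow>
        interp M i xs = interp M i (map (transpose a b) xs))" (is "?l = ?r")
    if ab: "a \<notin> D" "b \<notin> D"
  proof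
    assume ?l
    show ?r
    proof (intro allI impI, elim conjE)
      fix i xs assume xs: "i < length L" "length xs = L ! i" "set xs \<subseteq> insert a D"
      let ?ps = "map (\<lambda>x. (x, transpose a b x)) xs"
      have "set ?ps \<subseteq> insert (a, b) (Id_on D)"
        using xs(3) ab by (auto simp: transpose_def split: if_splits)
      then have "interp M i (map fst ?ps) = interp M i (map snd ?ps)"
        using partial_iso_rel[OF \<open>?l\<close> xs(1), of ?ps] xs(2) by (simp only: length_map)
      then show "interp M i xs = interp M i (map (transpose a b) xs)" by (simp add: comp_def)
    qed
  next
    assume r: ?r
    show ?l
    proof (rule partial_isoI)
      fix i ps assume ps: "i < length L" "length ps = L ! i" "set ps \<subseteq> insert (a, b) (Id_on D)"
      have "map snd ps = map (transpose a b) (map fst ps)"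
        using ps(3) ab by (auto simp: transpose_def)
      moreover have "set (map fst ps) \<subseteq> insert a D" using ps(3) by auto
      ultimately show "interp M i (map fst ps) = interp M i (map snd ps)"
        using r ps by (metis length_map)
    qed (use ab in auto)
  qed
  then show ?thesis unfolding same_type_def by blast
qed

lemma equiv_same_type: "equiv (V - D) (same_type D)"
proof (rule equivI)
  show "same_type D \<subseteq> (V - D) \<times> (V - D)" by (auto simp: same_type_def)
  show "refl_on (V - D) (same_type D)"
    by (auto simp: refl_on_def same_type_iff)
  show "sym (same_type D)"
  proof (rule symI)
    fix a b assume "(a, b) \<in> same_type D"
    moreover have "(insert (a, b) (Id_on D))\<inverse> = insert (b, a) (Id_on D)" by auto
    ultimately show "(b, a) \<in> same_type D"
      unfolding same_type_def using partial_iso_converse[of L M M "insert (a, b) (Id_on D)"] by auto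
  qed
  show "trans (same_type D)"
  proof (rule transI)
    fix a b c assume "(a, b) \<in> same_type D" "(b, c) \<in> same_type D"
    moreover have "insert (a, c) (Id_on D) \<subseteq> insert (a, b) (Id_on D) O insert (b, c) (Id_on D)" by auto
    ultimately show "(a, c) \<in> same_type D"
      unfolding same_type_def by (auto intro: partial_iso_subset[OF partial_iso_comp])
  qed
qed

lemma same_type_antimono: "D \<subseteq> D' \<Longrightarrow> same_type D' \<subseteq> same_type D"
  unfolding same_type_def by (auto elim: partial_iso_subset)

lemma similar_imp_same_type:
  assumes "(a, b) \<in> similar L M" "a \<notin> D" "b \<notin> D" "D \<subseteq> V"
  shows "(a, b) \<in> same_type D"
  unfolding same_type_iff
proof (intro conjI allI impI)
  show "a \<in> V - D" "b \<in> V - D" using assms by (auto simp: similar_def)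
  fix i xs assume "i < length L" "length xs = L ! i \<and> set xs \<subseteq> insert a D"
  then show "interp M i xs = interp M i (map (transpose a b) xs)"
    using similar_rel[OF assms(1), of i xs] assms \<open>a \<in> V - D\<close> by auto
qed

lemma transpose_idle: "a \<notin> set xs \<Longrightarrow> b \<notin> set xs \<Longrightarrow> map (transpose a b) xs = xs"
  by (auto intro!: map_idI simp: transpose_def)

lemma card_tuple: "i < length L \<Longrightarrow> length xs = L ! i \<Longrightarrow> card (set xs) \<le> k"
  using card_length[of xs] arity_le[of i] by simp

lemma card_tuple_remove:
  assumes "i < length L" "length xs = L ! i" "a \<in> set xs" "U \<subseteq> set xs - {a}"
  shows "card U \<le> k - 1"
proof -
  have "card U \<le> card (set xs - {a})" using assms(4) by (intro card_mono) auto
  also have "\<dots> \<le> k - 1" using card_tuple[OF assms(1,2)] assms(3) by simp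
  finally show ?thesis .
qed

text \<open>A tuple has at most \<open>k - 1\<close> elements besides a distinguished one, so
  \<open>U\<close> can be the whole context of that element. The number of types may also fall,
  since elements of \<open>U\<close> no longer have a type.\<close>

definition saturated :: "'a set \<Rightarrow> bool" where
  "saturated D \<longleftrightarrow> (\<forall>U\<subseteq>V - D. card U \<le> k - 1 \<longrightarrow> num_types (D \<union> U) \<le> num_types D)"

text \<open>If \<open>U\<close> swallows no type, every type over \<open>D\<close> keeps a member
  outside \<open>U\<close>; splitting one of them would then raise the number of types, against
  saturation.\<close>

lemma saturated_same_type:
  assumes "saturated D" "U \<subseteq> V - D" "card U \<le> k - 1"
    and not_swallowed: "\<And>K. K \<in> (V - D) // same_type D \<Longrightarrow> \<not> K \<subseteq> U"
    and ab: "(a, b) \<in> same_type D" "a \<notin> U" "b \<notin> U"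
  shows "(a, b) \<in> same_type (D \<union> U)"
proof (rule ccontr)
  assume n: "(a, b) \<notin> same_type (D \<union> U)"
  have "card ((V - D) // same_type D) < card ((V - (D \<union> U)) // same_type (D \<union> U))"
  proof (rule card_quotient_less)
    show "\<exists>b\<in>V - (D \<union> U). (a, b) \<in> same_type D" if "a \<in> V - D" for a
    proof -
      have "\<not> same_type D `` {a} \<subseteq> U" using not_swallowed that by (auto intro: quotientI)
      then show ?thesis by (auto simp: same_type_def)
    qed
    show "a \<in> V - (D \<union> U)" "b \<in> V - (D \<union> U)" using ab by (auto simp: same_type_def)
    show "same_type (D \<union> U) \<subseteq> same_type D" by (rule same_type_antimono) auto
  qed (use n ab finite_universe equiv_same_type in auto)
  moreover have "num_types (D \<union> U) \<le> num_types D"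
    using assms(1-3) unfolding saturated_def by blast
  ultimately show False by (simp add: num_types_def)
qed

text \<open>A tuple containing both \<open>a\<close> and \<open>u\<close> has at most
  \<open>k - 2\<close> other elements, so it misses some \<open>s\<close> in \<open>D\<close>
  similar to \<open>u\<close>. Exchanging \<open>u\<close> for \<open>s\<close> turns it into a
  tuple over \<open>insert a D\<close>, where \<open>a\<close> and \<open>b\<close> are already
  indistinguishable. Hence no type splits.\<close>

lemma num_types_insert_similar:
  assumes S: "S \<in> V // similar L M" and "u \<in> S" "u \<notin> D" "D \<subseteq> V" "k - 1 \<le> card (S \<inter> D)"
  shows "num_types (insert u D) \<le> num_types D"
  unfolding num_types_def
proof (rule card_quotient_restrict)
  show "equiv (V - D) (same_type D)" "equiv (V - insert u D) (same_type (insert u D))"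
    by (rule equiv_same_type)+
  show "same_type (insert u D) \<subseteq> same_type D" by (rule same_type_antimono) auto
  fix a b assume a: "a \<in> V - insert u D" and b: "b \<in> V - insert u D" and ab: "(a, b) \<in> same_type D"
  show "(a, b) \<in> same_type (insert u D)"
    unfolding same_type_iff
  proof (intro conjI allI impI, rule a, rule b, elim conjE)
    fix i xs assume xs: "i < length L" "length xs = L ! i" "set xs \<subseteq> insert a (insert u D)"
    show "interp M i xs = interp M i (map (transpose a b) xs)"
    proof (cases "a \<in> set xs \<and> u \<in> set xs")
      case False
      then consider "a \<notin> set xs" | "set xs \<subseteq> insert a D" using xs(3) by blast
      then show ?thesis
      proof cases
        case 1
        then have "b \<notin> set xs" using xs(3) b by (cases "a = b") auto
        with 1 show ?thesis by (simp add: transpose_idle)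
      next
        case 2
        then show ?thesis using ab xs(1,2) unfolding same_type_iff by blast
      qed
    next
      case True
      have "card (set xs - {a, u}) = card (set xs) - 2"
        using True a by (subst card_Diff_subset) auto
      moreover have "2 \<le> card (set xs)"
        using True a card_mono[of "set xs" "{a, u}"] by auto
      ultimately have "card (set xs - {a, u}) < k - 1"
        using card_tuple[OF xs(1,2)] by linarith
      then have "\<not> S \<inter> D \<subseteq> set xs - {a, u}"
        using assms(5) card_mono[of "set xs - {a, u}" "S \<inter> D"] by auto
      then obtain s where s: "s \<in> S" "s \<in> D" "s \<notin> set xs" using a assms(3) by auto
      have us: "(u, s) \<in> similar L M"
        using S s(1) assms(2) equiv_similar[of M L] by (meson quotient_eq_iff)
      let ?t = "transpose u s" and ?r = "transpose a b"
      have V: "set xs \<subseteq> V" using xs(3) a assms(4) us by (auto simp: similar_def)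
      have sub: "set (map ?t xs) \<subseteq> insert a D"
        using xs(3) s a by (auto simp: transpose_def split: if_splits)
      have "interp M i xs = interp M i (map ?t xs)"
        using similar_rel[OF us xs(1,2) V] by simp
      also have "\<dots> = interp M i (map ?r (map ?t xs))"
        using ab xs(1,2) sub unfolding same_type_iff by (metis length_map)
      also have "\<dots> = interp M i (map ?t (map ?r (map ?t xs)))"
        by (rule similar_rel[OF us, symmetric])
          (use xs V a b us s in \<open>auto simp: transpose_def similar_def\<close>)
      \<comment> \<open>Conjugation by \<open>?t\<close> leaves \<open>?r\<close> unchanged, as
        \<open>u\<close> and \<open>s\<close> both differ from \<open>a\<close> and
        \<open>b\<close>.\<close>
      also have "map ?t (map ?r (map ?t xs)) = map ?r xs"
        using a b s by (auto simp: transpose_def)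
      finally show ?thesis .
    qed
  qed
qed (simp_all add: finite_universe Diff_mono subset_insertI)

text \<open>Among the extensions that pay at most \<open>k - 1\<close> elements per type gained,
  take one with the most types; if it were not saturated, a violating \<open>U\<close> would give a
  better one. The last clause, which later bounds the similarity classes, comes from taking
  \<open>U\<close> of least size.\<close>

lemma saturate:
  assumes "X \<subseteq> V" "Y \<subseteq> V" "X \<inter> Y = {}"
  obtains X' where "X \<subseteq> X'" "X' \<subseteq> V" "X' \<inter> Y = {}" "saturated (X' \<union> Y)"
    "card X' + (k - 1) * num_types (X \<union> Y) \<le> card X + (k - 1) * num_types (X' \<union> Y)"
    "\<And>S. S \<in> V // similar L M \<Longrightarrow> card (S \<inter> X') \<le> max (card (S \<inter> X)) (k - 1)"
proof -
  define good where "good X' \<longleftrightarrow> X \<subseteq> X' \<and> X' \<subseteq> V \<and> X' \<inter> Y = {} \<and>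
    card X' + (k - 1) * num_types (X \<union> Y) \<le> card X + (k - 1) * num_types (X' \<union> Y) \<and>
    (\<forall>S\<in>V // similar L M. card (S \<inter> X') \<le> max (card (S \<inter> X)) (k - 1))" for X'
  have "good X" using assms by (auto simp: good_def)
  moreover have "num_types D < Suc (card V)" for D
  proof -
    have "num_types D \<le> card ((\<lambda>a. same_type D `` {a}) ` (V - D))"
      unfolding num_types_def using finite_universe
      by (intro card_mono) (auto elim!: quotientE)
    also have "\<dots> \<le> card V"
      using finite_universe by (meson Diff_subset card_image_le card_mono finite_Diff le_trans)
    finally show ?thesis by simp
  qed
  ultimately obtain X' where X': "good X'"
    and max: "\<And>X''. good X'' \<Longrightarrow> num_types (X'' \<union> Y) \<le> num_types (X' \<union> Y)"
    using ex_has_greatest_nat[of good X "\<lambda>X'. num_types (X' \<union> Y)" "Suc (card V)"] by blast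
  have "saturated (X' \<union> Y)"
  proof (rule ccontr)
    define P where "P U \<longleftrightarrow> U \<subseteq> V - (X' \<union> Y) \<and> card U \<le> k - 1 \<and>
      num_types (X' \<union> Y) < num_types (X' \<union> Y \<union> U)" for U
    assume "\<not> saturated (X' \<union> Y)"
    then obtain U0 where "P U0" unfolding saturated_def P_def by (meson not_le)
    then obtain U where PU: "P U" and min: "\<And>U'. P U' \<Longrightarrow> card U \<le> card U'"
      using ex_has_least_nat[of P U0 card] by blast
    have U: "U \<subseteq> V - (X' \<union> Y)" "card U \<le> k - 1" "num_types (X' \<union> Y) < num_types (X' \<union> Y \<union> U)"
      using PU by (auto simp: P_def)
    have finU: "finite U" by (rule finite_subset[OF _ finite_universe]) (use U in auto)
    have "good (X' \<union> U)"
      unfolding good_def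
    proof (intro conjI ballI)
      show "X \<subseteq> X' \<union> U" "X' \<union> U \<subseteq> V" "(X' \<union> U) \<inter> Y = {}"
        using X' U by (auto simp: good_def)
      have "card (X' \<union> U) + (k - 1) * num_types (X \<union> Y) \<le>
          card X' + card U + (k - 1) * num_types (X \<union> Y)"
        using card_Un_le[of X' U] by simp
      also have "\<dots> \<le> card X + (k - 1) * num_types (X' \<union> Y) + (k - 1)"
        using X' U unfolding good_def by linarith
      also have "\<dots> = card X + (k - 1) * Suc (num_types (X' \<union> Y))" by simp
      also have "\<dots> \<le> card X + (k - 1) * num_types (X' \<union> U \<union> Y)"
        using U by (intro add_left_mono mult_le_mono2) (simp add: Un_ac)
      finally show "card (X' \<union> U) + (k - 1) * num_types (X \<union> Y)
        \<le> card X + (k - 1) * num_types (X' \<union> U \<union> Y)" .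
      fix S assume S: "S \<in> V // similar L M"
      show "card (S \<inter> (X' \<union> U)) \<le> max (card (S \<inter> X)) (k - 1)"
      proof (cases "S \<inter> U = {}")
        case True
        then have "S \<inter> (X' \<union> U) = S \<inter> X'" by auto
        then show ?thesis using X' S by (simp add: good_def)
      next
        case False
        then obtain u where u: "u \<in> S" "u \<in> U" by auto
        have "card (S \<inter> (X' \<union> U)) \<le> k - 1"
        proof (rule ccontr)
          assume c: "\<not> card (S \<inter> (X' \<union> U)) \<le> k - 1"
          let ?D = "X' \<union> Y \<union> (U - {u})"
          have fin: "finite (S \<inter> ?D)" "finite (S \<inter> (X' \<union> U))"
            by (rule finite_subset[OF _ finite_universe], use X' U assms in \<open>auto simp: good_def\<close>)+
          have "card (S \<inter> (X' \<union> U) - {u}) \<le> card (S \<inter> ?D)"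
            using U u by (intro card_mono[OF fin(1)]) auto
          then have "k - 1 \<le> card (S \<inter> ?D)" using c u fin(2) by auto
          then have "num_types (insert u ?D) \<le> num_types ?D"
            using X' U assms u by (intro num_types_insert_similar[OF S u(1)]) (auto simp: good_def)
          moreover have "insert u ?D = X' \<union> Y \<union> U" using u by auto
          ultimately have "num_types (X' \<union> Y) < num_types ?D" using U by simp
          moreover have "card (U - {u}) \<le> k - 1"
            using U card_Diff1_le[of U u] by linarith
          ultimately have "P (U - {u})" using U by (auto simp: P_def)
          then have "card U \<le> card (U - {u})" by (rule min)
          then show False using u finU by (metis card_Diff1_less not_le)
        qed
        then show ?thesis by simp
      qed
    qed
    from max[OF this] U show False by (simp add: Un_ac)
  qed
  then show thesis using X' by (intro that[of X']) (auto simp: good_def)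
qed

end


subsection \<open>Layered bases\<close>

context bounded_arity_struct
begin

text \<open>A tuple avoiding \<open>R\<close> cannot swallow a type: such a type would have at most
  \<open>k\<close> elements and so meet \<open>R\<close>. Saturation therefore applies to the
  context of one entry, which cannot be told from an element of its type that is absent from the
  tuple.\<close>

lemma saturated_rel:
  assumes sat: "saturated D" and D: "D \<subseteq> V"
    and small: "\<And>K. K \<in> (V - D) // same_type D \<Longrightarrow> card K \<le> k \<Longrightarrow> K \<inter> R \<noteq> {}"
    and ab: "(a, b) \<in> same_type D"
    and large: "k < card (same_type D `` {a})" "same_type D `` {a} \<inter> R = {}"
    and xs: "i < length L" "length xs = L ! i" "set xs \<subseteq> V" "set xs \<inter> R = {}"
  shows "interp M i xs = interp M i (map (transpose a b) xs)"
proof -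
  have eq: "equiv (V - D) (same_type D)" by (rule equiv_same_type)
  let ?K = "same_type D `` {a}"
  have step: "interp M i xs = interp M i (map (transpose c d) xs)"
    if cd: "c \<in> ?K" "d \<in> ?K" and xs: "length xs = L ! i" "set xs \<subseteq> V" "set xs \<inter> R = {}" "d \<notin> set xs"
    for c d xs
  proof (cases "c \<in> set xs")
    case False
    then show ?thesis using xs(4) by (simp add: transpose_idle)
  next
    case True
    define U where "U = set xs - D - {c}"
    have U: "card U \<le> k - 1"
      using True by (intro card_tuple_remove[OF \<open>i < length L\<close> xs(1)]) (auto simp: U_def)
    have cdD: "(c, d) \<in> same_type D" using cd eq by (auto simp: equiv_def dest: symD transD)
    have "(c, d) \<in> same_type (D \<union> U)"
    proof (rule saturated_same_type[OF sat _ U _ cdD])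
      show "U \<subseteq> V - D" using xs(2) by (auto simp: U_def)
      show "c \<notin> U" "d \<notin> U" using xs(4) by (auto simp: U_def)
      fix K assume K: "K \<in> (V - D) // same_type D"
      show "\<not> K \<subseteq> U"
      proof
        assume KU: "K \<subseteq> U"
        then have "card K \<le> k"
          using card_mono[OF _ KU] U by (simp add: U_def)
        then have "K \<inter> R \<noteq> {}" by (rule small[OF K])
        then show False using KU xs(3) by (auto simp: U_def)
      qed
    qed
    moreover have "set xs \<subseteq> insert c (D \<union> U)" by (auto simp: U_def)
    ultimately show ?thesis using xs(1) \<open>i < length L\<close> unfolding same_type_iff by blast
  qed
  have aK: "a \<in> ?K" "b \<in> ?K" using ab eq by (auto simp: equiv_def refl_on_def same_type_def)
  consider "b \<notin> set xs" | "a \<notin> set xs" | "a \<in> set xs" "b \<in> set xs" "a \<noteq> b" | "a = b" by blast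
  then show ?thesis
  proof cases
    case 1
    then show ?thesis by (intro step aK xs)
  next
    case 2
    then show ?thesis by (subst transpose_commute) (intro step aK xs)
  next
    case 3
    \<comment> \<open>When the tuple contains both elements, their large type has a third element
      \<open>c\<close> outside it, and the exchange is made in three steps, each moving one entry to
      a currently absent element.\<close>
    have "\<not> ?K \<subseteq> set xs"
      using card_mono[of "set xs" ?K] card_tuple[OF xs(1,2)] large(1) by auto
    then obtain c where c: "c \<in> ?K" "c \<notin> set xs" by blast
    have V: "a \<in> V" "b \<in> V" "c \<in> V" using aK c by (auto simp: same_type_def)
    have R: "a \<notin> R" "b \<notin> R" "c \<notin> R" using aK c large(2) by auto
    have "a \<noteq> c" "b \<noteq> c" using 3 c by auto
    let ?ys = "map (transpose b c) xs" and ?zs = "map (transpose a b) (map (transpose b c) xs)"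
    have "interp M i xs = interp M i ?ys" by (intro step aK xs c)
    also have "\<dots> = interp M i ?zs"
    proof (rule step)
      show "set ?ys \<subseteq> V" "set ?ys \<inter> R = {}" "b \<notin> set ?ys"
        using xs c V R \<open>b \<noteq> c\<close> by (auto simp: transpose_def split: if_splits)
    qed (use xs aK in auto)
    also have "\<dots> = interp M i (map (transpose c a) ?zs)"
    proof (rule step)
      show "set ?zs \<subseteq> V" "set ?zs \<inter> R = {}" "a \<notin> set ?zs"
        using xs c V R \<open>b \<noteq> c\<close> \<open>a \<noteq> c\<close> \<open>a \<noteq> b\<close> by (auto simp: transpose_def split: if_splits)
    qed (use xs aK c in auto)
    also have "map (transpose c a) ?zs = map (transpose a b) xs"
      using c \<open>b \<noteq> c\<close> \<open>a \<noteq> c\<close> \<open>a \<noteq> b\<close> by (auto simp: transpose_def)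
    finally show ?thesis .
  qed (simp)
qed

text \<open>
  The set \<open>X\<close> is what the Spoiler selects explicitly; the elements of the \<open>j\<close> layers
  \<open>Ys (Suc i) - Ys i\<close> come for free because each is the only one of its type over \<open>X\<close>
  and the preceding layers. By the last condition two elements of the same type over \<open>X \<union> Ys j\<close>
  can only be told apart by tuples with at least \<open>j\<close> entries in \<open>Ys j\<close>, which is impossible
  for \<open>j = k - 1\<close>.
\<close>

definition layered_base :: "nat \<Rightarrow> 'a set \<Rightarrow> (nat \<Rightarrow> 'a set) \<Rightarrow> bool" where
  "layered_base j X Ys \<longleftrightarrow> X \<subseteq> V \<and> Ys j \<subseteq> V \<and> X \<inter> Ys j = {} \<and> Ys 0 = {} \<and>
     (\<forall>i<j. Ys i \<subseteq> Ys (Suc i)) \<and>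
     (\<forall>i<j. \<forall>a y. (a, y) \<in> same_type (X \<union> Ys i) \<and> y \<in> Ys (Suc i) \<longrightarrow> a = y) \<and>
     card X \<le> (k - 1) * (2 * card (Ys j) + num_types (X \<union> Ys j)) \<and>
     (\<forall>S\<in>V // similar L M. S \<inter> Ys j = {} \<and> card (S \<inter> X) \<le> k - 1 \<or>
        S \<subseteq> X \<union> Ys j \<and> card S \<le> 2 * k - 1) \<and>
     (\<forall>a b i xs. (a, b) \<in> same_type (X \<union> Ys j) \<and> i < length L \<and> length xs = L ! i \<and>
        set xs \<subseteq> V \<and> interp M i xs \<noteq> interp M i (map (transpose a b) xs) \<longrightarrow>
        j \<le> card (set xs \<inter> Ys j))"

lemma layered_base_0: "layered_base 0 {} (\<lambda>_. {})"
  by (auto simp: layered_base_def)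

text \<open>After saturation every type with at most \<open>k\<close> elements is dissolved: a
  representative joins the new layer as a member of \<open>R\<close>, the others join
  \<open>X\<close>. Each small type puts at most \<open>k - 1\<close> elements into \<open>X\<close>
  and accounts for at most one lost type; these two costs make up the factor 2 before the size of
  the layers. By \<open>saturated_rel\<close> a tuple separating elements of a remaining type meets
  \<open>R\<close>, in addition to its at least \<open>j\<close> elements of
  \<open>Y\<close>.\<close>

lemma layered_base_Suc:
  assumes base: "layered_base j X Ys"
  shows "\<exists>X' Ys'. layered_base (Suc j) X' Ys'"
proof -
  define Y where "Y = Ys j"
  note base' = base[unfolded layered_base_def, folded Y_def]
  have XY: "X \<subseteq> V" "Y \<subseteq> V" "X \<inter> Y = {}" "Ys 0 = {}"
    using base' by simp_all
  have incr: "Ys i \<subseteq> Ys (Suc i)" if "i < j" for i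
    using base' that by simp
  have uniq: "a = y" if "i < j" "(a, y) \<in> same_type (X \<union> Ys i)" "y \<in> Ys (Suc i)" for i a y
    using base' that by simp
  have cardX: "card X \<le> (k - 1) * (2 * card Y + num_types (X \<union> Y))"
    using base' by simp
  have sim: "S \<inter> Y = {} \<and> card (S \<inter> X) \<le> k - 1 \<or> S \<subseteq> X \<union> Y \<and> card S \<le> 2 * k - 1"
    if "S \<in> V // similar L M" for S
    using base' that by simp
  have bad: "j \<le> card (set xs \<inter> Y)"
    if "(a, b) \<in> same_type (X \<union> Y)" "i < length L" "length xs = L ! i" "set xs \<subseteq> V"
      "interp M i xs \<noteq> interp M i (map (transpose a b) xs)" for a b i xs
    using base' that by simp
  obtain X1 where X1: "X \<subseteq> X1" "X1 \<subseteq> V" "X1 \<inter> Y = {}" "saturated (X1 \<union> Y)"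
    "card X1 + (k - 1) * num_types (X \<union> Y) \<le> card X + (k - 1) * num_types (X1 \<union> Y)"
    and X1_sim: "\<And>S. S \<in> V // similar L M \<Longrightarrow> card (S \<inter> X1) \<le> max (card (S \<inter> X)) (k - 1)"
    using saturate[OF XY(1-3)] by blast
  define D where "D = X1 \<union> Y"
  define C where "C = (V - D) // same_type D"
  define Sm where "Sm = {K\<in>C. card K \<le> k}"
  have DV: "D \<subseteq> V" using X1 XY by (auto simp: D_def)
  have eq: "equiv (V - D) (same_type D)" by (rule equiv_same_type)
  have finC: "finite C"
    unfolding C_def using finite_universe eq by (auto simp: finite_quotient equiv_def)
  have finSm: "finite Sm" using finC by (auto simp: Sm_def)
  have K_sub: "K \<subseteq> V - D" "K \<noteq> {}" if "K \<in> C" for K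
    using that in_quotient_imp_subset[OF eq] in_quotient_imp_non_empty[OF eq] by (auto simp: C_def)
  have K_disj: "K = K' \<or> K \<inter> K' = {}" if "K \<in> C" "K' \<in> C" for K K'
    using that quotient_disj[OF eq] by (auto simp: C_def)
  define rep where "rep K = (SOME a. a \<in> K)" for K :: "'a set"
  have rep: "rep K \<in> K" if "K \<in> C" for K
    using K_sub(2)[OF that] unfolding rep_def by (simp add: some_in_eq)
  define R where "R = rep ` Sm"
  define X2 where "X2 = X1 \<union> (\<Union>Sm - R)"
  define Y2 where "Y2 = Y \<union> R"
  have R_sub: "R \<subseteq> \<Union>Sm" using rep by (auto simp: R_def Sm_def)
  have Sm_sub: "\<Union>Sm \<subseteq> V - D" using K_sub(1) by (auto simp: Sm_def)
  have RV: "R \<subseteq> V - D" by (rule subset_trans[OF R_sub Sm_sub])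
  have finU: "finite (\<Union>Sm)" by (rule finite_subset[OF _ finite_universe]) (use Sm_sub in auto)
  have finY: "finite Y" by (rule finite_subset[OF XY(2) finite_universe])
  have D2: "X2 \<union> Y2 = D \<union> \<Union>Sm" using R_sub by (auto simp: X2_def Y2_def D_def)
  have "inj_on rep Sm"
  proof (rule inj_onI)
    fix K K' assume "K \<in> Sm" "K' \<in> Sm" and eq: "rep K = rep K'"
    then have C: "K \<in> C" "K' \<in> C" by (auto simp: Sm_def)
    have "rep K \<in> K \<inter> K'" using rep[OF C(1)] rep[OF C(2)] eq by simp
    then show "K = K'" using K_disj[OF C] by blast
  qed
  then have cardR: "card R = card Sm" by (simp add: R_def card_image)
  have cardU: "card (\<Union>Sm) \<le> card Sm * k"
  proof -
    have "card (\<Union>Sm) \<le> sum card Sm" by (rule card_Union_le_sum_card)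
    also have "\<dots> \<le> card Sm * k" using sum_bounded_above[of Sm card k] by (simp add: Sm_def)
    finally show ?thesis .
  qed
  have "card (\<Union>Sm - R) = card (\<Union>Sm) - card Sm"
    using R_sub finU cardR by (metis card_Diff_subset finite_subset)
  with cardU have cardUR: "card (\<Union>Sm - R) \<le> card Sm * (k - 1)"
    by (simp add: diff_mult_distrib2)
  have cardY2: "card Y2 = card Y + card Sm"
    unfolding Y2_def cardR[symmetric] using R_sub Sm_sub finU finY
    by (intro card_Un_disjoint) (auto intro: finite_subset simp: D_def)
  \<comment> \<open>Large types are disjoint from the small ones and keep their elements, so each
    still contains a class over the larger set; only small types can vanish from the count.\<close>
  have types: "num_types D \<le> card Sm + num_types (X2 \<union> Y2)"
  proof -
    let ?s = "same_type (D \<union> \<Union>Sm)"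
    have eq2: "equiv (V - (D \<union> \<Union>Sm)) ?s" by (rule equiv_same_type)
    have sub: "?s \<subseteq> same_type D" by (rule same_type_antimono) auto
    have "C \<subseteq> Sm \<union> (\<lambda>K. same_type D `` K) ` ((V - (D \<union> \<Union>Sm)) // ?s)"
    proof
      fix K assume K: "K \<in> C"
      show "K \<in> Sm \<union> (\<lambda>K. same_type D `` K) ` ((V - (D \<union> \<Union>Sm)) // ?s)"
      proof (cases "K \<in> Sm")
        case False
        obtain a where a: "a \<in> V - D" "K = same_type D `` {a}" using K by (auto simp: C_def elim!: quotientE)
        then have "a \<in> K" using eq by (auto simp: equiv_def refl_on_def)
        then have "a \<notin> \<Union>Sm" using K_disj[OF K] False by (auto simp: Sm_def)
        then have a2: "a \<in> V - (D \<union> \<Union>Sm)" using a by auto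
        then have "K = same_type D `` (?s `` {a})"
          using quotient_coarsen[OF eq eq2 _ sub a2] a by auto
        then show ?thesis using a2 by (auto intro: quotientI)
      qed simp
    qed
    moreover have fin: "finite ((V - (D \<union> \<Union>Sm)) // ?s)"
      using finite_universe eq2 by (auto simp: finite_quotient equiv_def)
    ultimately have "card C \<le> card (Sm \<union> (\<lambda>K. same_type D `` K) ` ((V - (D \<union> \<Union>Sm)) // ?s))"
      using finSm by (intro card_mono) auto
    also have "\<dots> \<le> card Sm + card ((\<lambda>K. same_type D `` K) ` ((V - (D \<union> \<Union>Sm)) // ?s))"
      by (rule card_Un_le)
    also have "\<dots> \<le> card Sm + card ((V - (D \<union> \<Union>Sm)) // ?s)"
      using card_image_le[OF fin] by simp
    finally show ?thesis unfolding num_types_def C_def D2 .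
  qed
  define Ys2 where "Ys2 = Ys(Suc j := Y2)"
  have Ys2: "Ys2 (Suc j) = Y2" "\<And>i. i \<le> j \<Longrightarrow> Ys2 i = Ys i" by (auto simp: Ys2_def)
  have XX2: "X \<subseteq> X2" using X1 by (auto simp: X2_def)
  have large: "k < card (same_type D `` {a})" "same_type D `` {a} \<inter> R = {}"
    if "a \<in> V - (D \<union> \<Union>Sm)" for a
  proof -
    let ?K = "same_type D `` {a}"
    have K: "?K \<in> C" using that by (auto simp: C_def intro: quotientI)
    have "a \<in> ?K" using that eq by (auto simp: equiv_def refl_on_def)
    then have n: "?K \<notin> Sm" using that by auto
    then show "k < card ?K" using K by (auto simp: Sm_def)
    show "?K \<inter> R = {}"
    proof (rule ccontr)
      assume "?K \<inter> R \<noteq> {}"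
      then obtain K' where K': "K' \<in> Sm" "?K \<inter> K' \<noteq> {}" using R_sub by blast
      then have "?K = K'" using K_disj[OF K, of K'] by (auto simp: Sm_def)
      with K' n show False by simp
    qed
  qed
  have "layered_base (Suc j) X2 Ys2"
    unfolding layered_base_def Ys2(1)
  proof (intro conjI allI impI ballI)
    show "X2 \<subseteq> V" using X1 Sm_sub by (auto simp: X2_def)
    show "Y2 \<subseteq> V" using XY RV unfolding Y2_def by blast
    show "X2 \<inter> Y2 = {}" using X1 RV Sm_sub unfolding X2_def Y2_def D_def by blast
    show "Ys2 0 = {}" using XY by (simp add: Ys2)
  next
    fix i assume "i < Suc j"
    then show "Ys2 i \<subseteq> Ys2 (Suc i)"
      using incr[of i] Ys2(1) by (cases "i = j") (auto simp: Ys2(2) Y2_def Y_def)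
  next
    fix i a y assume "i < Suc j" and ay: "(a, y) \<in> same_type (X2 \<union> Ys2 i) \<and> y \<in> Ys2 (Suc i)"
    show "a = y"
    proof (cases "i = j")
      \<comment> \<open>In the new layer \<open>y\<close> is the representative of a small type
        \<open>K\<close> whose other members lie in \<open>X2\<close>, so nothing but
        \<open>y\<close> is left of that type.\<close>
      case True
      then have st: "(a, y) \<in> same_type (X2 \<union> Y)" and y: "y \<in> Y2"
        using ay by (auto simp: Ys2 Y_def)
      then have "y \<in> R" by (auto simp: Y2_def same_type_def)
      then obtain K where K: "K \<in> Sm" "y \<in> K" using R_sub by auto
      have "(a, y) \<in> same_type D"
        using st same_type_antimono[of D "X2 \<union> Y"] by (auto simp: D_def X2_def)
      then have "a \<in> K"
        using K eq by (metis (no_types, lifting) C_def Sm_def equiv_def in_quotient_imp_closed mem_Collect_eq symD)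
      then have "a \<in> R" using K st by (auto simp: X2_def same_type_def)
      moreover have "r = r'" if rr: "r \<in> R" "r' \<in> R" "r \<in> K" "r' \<in> K" for r r'
      proof -
        have "r = rep K" if r: "r \<in> R" "r \<in> K" for r
        proof -
          obtain K' where K': "K' \<in> Sm" "r = rep K'" using r by (auto simp: R_def)
          then have "r \<in> K'" using rep by (auto simp: Sm_def)
          then have "K' = K" using K_disj[of K' K] K K' r by (auto simp: Sm_def)
          with K' show ?thesis by simp
        qed
        then show ?thesis using rr by metis
      qed
      ultimately show ?thesis using \<open>a \<in> K\<close> \<open>y \<in> R\<close> K by blast
    next
      case False
      then have i: "i < j" using \<open>i < Suc j\<close> by simp
      then have st: "(a, y) \<in> same_type (X2 \<union> Ys i)" and y: "y \<in> Ys (Suc i)"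
        using ay by (auto simp: Ys2)
      have "(a, y) \<in> same_type (X \<union> Ys i)"
        using st same_type_antimono[of "X \<union> Ys i" "X2 \<union> Ys i"] XX2 by blast
      then show ?thesis using uniq[OF i] y by blast
    qed
  next
    have "card X2 \<le> card X1 + card Sm * (k - 1)"
      unfolding X2_def using card_Un_le[of X1 "\<Union>Sm - R"] cardUR by linarith
    moreover have "card X1 \<le> (k - 1) * (2 * card Y) + (k - 1) * num_types D"
      using X1(5) cardX unfolding D_def by (simp add: add_mult_distrib2)
    moreover have "(k - 1) * num_types D \<le> (k - 1) * (card Sm + num_types (X2 \<union> Y2))"
      using types by (rule mult_le_mono2)
    ultimately show "card X2 \<le> (k - 1) * (2 * card Y2 + num_types (X2 \<union> Y2))"
      unfolding cardY2 by (simp add: algebra_simps)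
  next
    fix S assume S: "S \<in> V // similar L M"
    have finS: "finite S"
      by (rule finite_subset[OF in_quotient_imp_subset[OF equiv_similar S] finite_universe])
    show "S \<inter> Y2 = {} \<and> card (S \<inter> X2) \<le> k - 1 \<or> S \<subseteq> X2 \<union> Y2 \<and> card S \<le> 2 * k - 1"
      using sim[OF S]
    proof
      assume "S \<subseteq> X \<union> Y \<and> card S \<le> 2 * k - 1"
      then show ?thesis using XX2 by (auto simp: Y2_def)
    next
      assume a: "S \<inter> Y = {} \<and> card (S \<inter> X) \<le> k - 1"
      then have c1: "card (S \<inter> X1) \<le> k - 1" using X1_sim[OF S] by linarith
      show ?thesis
      proof (cases "S \<inter> \<Union>Sm = {}")
        case True
        then have "S \<inter> X2 = S \<inter> X1" "S \<inter> Y2 = {}" using a R_sub by (auto simp: X2_def Y2_def)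
        with c1 show ?thesis by simp
      next
        case False
        then obtain s K where s: "s \<in> S" "K \<in> Sm" "s \<in> K" by auto
        \<comment> \<open>Members of \<open>S\<close> outside \<open>X1\<close> are also outside
          \<open>Y\<close>, hence share the type of \<open>s\<close> over \<open>D\<close> and lie
          in \<open>K\<close>. So \<open>S\<close> is absorbed entirely, with at most
          \<open>k - 1\<close> elements from \<open>X1\<close> and \<open>k\<close> from
          \<open>K\<close>.\<close>
        have sK: "t \<in> K" if t: "t \<in> S" "t \<notin> X1" for t
        proof -
          have "(s, t) \<in> similar L M"
            using S s(1) t(1) equiv_similar[of M L] by (meson quotient_eq_iff)
          then have "(s, t) \<in> same_type D"
            using a t s Sm_sub DV by (intro similar_imp_same_type) (auto simp: D_def)
          then show ?thesis
            using s(2,3) eq unfolding Sm_def C_def by (metis (no_types, lifting) in_quotient_imp_closed mem_Collect_eq)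
        qed
        have "S \<subseteq> X2 \<union> Y2" unfolding D2 using sK s(2) by (auto simp: D_def)
        moreover have "card S \<le> 2 * k - 1"
        proof -
          have finK: "finite K" using s(2) finU by (meson Union_upper finite_subset)
          have "card S \<le> card ((S \<inter> X1) \<union> K)"
            using sK finS finK by (intro card_mono) auto
          also have "\<dots> \<le> card (S \<inter> X1) + card K" by (rule card_Un_le)
          also have "\<dots> \<le> (k - 1) + k" using c1 s(2) by (auto simp: Sm_def intro: add_mono)
          finally show ?thesis by simp
        qed
        ultimately show ?thesis by blast
      qed
    qed
  next
    fix a b i xs
    assume asm: "(a, b) \<in> same_type (X2 \<union> Y2) \<and> i < length L \<and> length xs = L ! i \<and> set xs \<subseteq> V \<and>
      interp M i xs \<noteq> interp M i (map (transpose a b) xs)"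
    have abD: "(a, b) \<in> same_type D" "a \<in> V - (D \<union> \<Union>Sm)"
      using asm same_type_antimono[of D "X2 \<union> Y2"] unfolding D2 by (auto simp: same_type_def)
    have "(a, b) \<in> same_type (X \<union> Y)"
      using abD same_type_antimono[of "X \<union> Y" D] X1(1) by (auto simp: D_def)
    then have j: "j \<le> card (set xs \<inter> Y)" using bad asm by blast
    have "set xs \<inter> R \<noteq> {}"
    proof
      assume R: "set xs \<inter> R = {}"
      have "interp M i xs = interp M i (map (transpose a b) xs)"
      proof (rule saturated_rel[OF _ DV _ abD(1) large[OF abD(2)]])
        show "saturated D" using X1 by (simp add: D_def)
        show "K \<inter> R \<noteq> {}" if "K \<in> (V - D) // same_type D" "card K \<le> k" for K
          using that rep[of K] by (auto simp: R_def Sm_def C_def)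
      qed (use asm R in auto)
      with asm show False by simp
    qed
    then have "0 < card (set xs \<inter> R)" by (simp add: card_gt_0_iff)
    moreover have "card (set xs \<inter> Y2) = card (set xs \<inter> Y) + card (set xs \<inter> R)"
    proof -
      have "set xs \<inter> Y2 = (set xs \<inter> Y) \<union> (set xs \<inter> R)" by (auto simp: Y2_def)
      moreover have "(set xs \<inter> Y) \<inter> (set xs \<inter> R) = {}" using RV by (auto simp: D_def)
      ultimately show ?thesis by (simp add: card_Un_disjoint)
    qed
    ultimately show "Suc j \<le> card (set xs \<inter> Y2)" using j by linarith
  qed
  then show ?thesis by blast
qed

lemma ex_layered_base: "\<exists>X Ys. layered_base j X Ys"
  by (induction j) (use layered_base_0 layered_base_Suc in blast)+

text \<open>A separating tuple has \<open>k - 1\<close> elements in the layers and so at most one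
  elsewhere. It must contain \<open>a\<close> or \<open>b\<close>, which is that one; the tuple then
  lies over the base apart from it, where having the same type decides.\<close>

lemma layered_base_similar:
  assumes base: "layered_base (k - 1) X Ys" and ab: "(a, b) \<in> same_type (X \<union> Ys (k - 1))"
  shows "(a, b) \<in> similar L M"
proof (rule similarI)
  show "a \<in> V" "b \<in> V" using ab by (auto simp: same_type_def)
  fix i xs assume xs: "i < length L" "length xs = L ! i" "set xs \<subseteq> V"
  let ?Y = "Ys (k - 1)"
  show "interp M i xs = interp M i (map (transpose a b) xs)"
  proof (rule ccontr)
    assume neq: "interp M i xs \<noteq> interp M i (map (transpose a b) xs)"
    then have k: "k - 1 \<le> card (set xs \<inter> ?Y)"
      using base ab xs unfolding layered_base_def by simp
    have one: "set xs \<subseteq> insert c (X \<union> ?Y)" if "c \<in> set xs" "c \<notin> ?Y" for c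
    proof -
      have "set xs \<inter> ?Y = set xs - {c}"
      proof (rule card_seteq)
        show "card (set xs - {c}) \<le> card (set xs \<inter> ?Y)"
          using card_tuple_remove[OF xs(1,2) that(1)] k by (meson order_refl order_trans)
      qed (use that in auto)
      then show ?thesis by auto
    qed
    have ba: "(b, a) \<in> same_type (X \<union> ?Y)" using ab equiv_same_type by (meson equiv_def symD)
    consider "a \<in> set xs" | "b \<in> set xs" | "a \<notin> set xs" "b \<notin> set xs" by blast
    then show False
    proof cases
      case 1
      then have "set xs \<subseteq> insert a (X \<union> ?Y)" using one ab by (auto simp: same_type_def)
      then show False using ab xs neq unfolding same_type_iff by blast
    next
      case 2
      then have "set xs \<subseteq> insert b (X \<union> ?Y)" using one ab by (auto simp: same_type_def)
      then have "interp M i xs = interp M i (map (transpose b a) xs)"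
        using ba xs unfolding same_type_iff by blast
      then show False using neq by (simp add: transpose_commute)
    next
      case 3
      then show False using neq by (simp add: transpose_idle)
    qed
  qed
qed

text \<open>There are at most |Z| types on the remainder Z, so |X| is at most (k - 1)(2|Y| + |Z|),
  while n = |X| + |Y| + |Z|. The outcome is the bound of |X| + |Z|/2 by (1 - 1/(2k)) n, cleared of
  denominators.\<close>

lemma layered_base_card:
  assumes "layered_base j X Ys"
  shows "2 * k * card X + k * card (V - (X \<union> Ys j)) \<le> (2 * k - 1) * card V"
proof -
  let ?Y = "Ys j" let ?Z = "V - (X \<union> Ys j)"
  have sub: "X \<subseteq> V" "?Y \<subseteq> V" "X \<inter> ?Y = {}"
    and cardX: "card X \<le> (k - 1) * (2 * card ?Y + num_types (X \<union> ?Y))"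
    using assms by (auto simp: layered_base_def)
  have fin: "finite X" "finite ?Y" using sub finite_universe by (auto intro: finite_subset)
  have n: "card V = card X + card ?Y + card ?Z"
    using sub fin finite_universe
    by (metis card_Diff_subset card_Un_disjoint card_mono finite_Un le_add_diff_inverse le_sup_iff)
  have "num_types (X \<union> ?Y) \<le> card ((\<lambda>a. same_type (X \<union> ?Y) `` {a}) ` ?Z)"
    unfolding num_types_def using finite_universe by (intro card_mono) (auto elim!: quotientE)
  also have "\<dots> \<le> card ?Z" using finite_universe by (intro card_image_le) auto
  finally have "card X \<le> (k - 1) * (2 * card ?Y + card ?Z)"
    using cardX by (meson add_left_mono le_trans mult_le_mono2)
  then have "int (card X) \<le> (int k - 1) * (2 * int (card ?Y) + int (card ?Z))"
    using k_pos by (metis (mono_tags, opaque_lifting) One_nat_def Suc_leI of_nat_1 of_nat_add of_nat_diff of_nat_le_iff of_nat_mult of_nat_numeral)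
  moreover have "0 \<le> int (card ?Y)" "0 \<le> int (card ?Z)" by auto
  ultimately have "2 * int k * int (card X) + int k * int (card ?Z) \<le>
      (2 * int k - 1) * (int (card X) + int (card ?Y) + int (card ?Z))"
    by (simp add: algebra_simps)
  then have "int (2 * k * card X + k * card ?Z) \<le> int ((2 * k - 1) * (card X + card ?Y + card ?Z))"
    using k_pos by (simp add: of_nat_diff)
  then show ?thesis unfolding n by linarith
qed

end


subsection \<open>Forced matchings\<close>

text \<open>Difunctionality makes any two rows of \<open>r\<close> equal or disjoint. Elements
  compete only with those having the same row, so Hall's condition reduces to comparing each group
  with its row, and injections chosen group by group fit together.\<close>

lemma ex_injection_difunctional:
  assumes "finite A" and fin: "\<And>a. a \<in> A \<Longrightarrow> finite (r `` {a})"
    and difun: "\<And>a b x y. (a, x) \<in> r \<Longrightarrow> (b, x) \<in> r \<Longrightarrow> (a, y) \<in> r \<Longrightarrow> (b, y) \<in> r"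
    and size: "\<And>a. a \<in> A \<Longrightarrow> card {b\<in>A. r `` {b} = r `` {a}} \<le> card (r `` {a})"
  obtains h where "inj_on h A" "\<And>a. a \<in> A \<Longrightarrow> (a, h a) \<in> r"
proof -
  have "\<exists>f. f ` {b\<in>A. r `` {b} = T} \<subseteq> T \<and> inj_on f {b\<in>A. r `` {b} = T}"
    if "T \<in> (\<lambda>a. r `` {a}) ` A" for T
    using that size fin assms(1) by (intro card_le_inj) auto
  then have "\<exists>f. \<forall>T\<in>(\<lambda>a. r `` {a}) ` A.
      f T ` {b\<in>A. r `` {b} = T} \<subseteq> T \<and> inj_on (f T) {b\<in>A. r `` {b} = T}"
    by (intro bchoice ballI)
  then obtain f where f: "\<And>T. T \<in> (\<lambda>a. r `` {a}) ` A \<Longrightarrow>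
      f T ` {b\<in>A. r `` {b} = T} \<subseteq> T \<and> inj_on (f T) {b\<in>A. r `` {b} = T}"
    by blast
  define h where "h a = f (r `` {a}) a" for a
  have h: "(a, h a) \<in> r" if a: "a \<in> A" for a
  proof -
    have "a \<in> {b\<in>A. r `` {b} = r `` {a}}" using a by simp
    then have "h a \<in> r `` {a}" using f[of "r `` {a}"] a unfolding h_def by blast
    then show ?thesis by simp
  qed
  moreover have "inj_on h A"
  proof (rule inj_onI)
    fix a b assume ab: "a \<in> A" "b \<in> A" "h a = h b"
    have "(a, h a) \<in> r" "(b, h a) \<in> r" using h[OF ab(1)] h[OF ab(2)] ab(3) by simp_all
    then have eq: "r `` {a} = r `` {b}" by (blast intro: difun)
    have "inj_on (f (r `` {a})) {c\<in>A. r `` {c} = r `` {a}}" using f ab(1) by blast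
    moreover have "f (r `` {a}) a = f (r `` {a}) b" using ab(3) eq by (simp add: h_def)
    ultimately show "a = b" by (rule inj_onD) (use ab eq in auto)
  qed
  ultimately show thesis using that by blast
qed

lemma map_transpose_inj_on:
  assumes "inj_on h B" "set xs \<subseteq> B" "u \<in> B" "v \<in> B"
  shows "map h (map (transpose u v) xs) = map (transpose (h u) (h v)) (map h xs)"
proof -
  have "h (transpose u v x) = transpose (h u) (h v) (h x)" if "x \<in> B" for x
    using assms(1,3,4) that by (auto simp: transpose_def inj_on_eq_iff)
  then show ?thesis using assms(2) by auto
qed

text \<open>A tuple over \<open>N\<close> is pulled back along an injection \<open>h\<close> inside
  \<open>r\<close>, the exchange is made in \<open>M\<close>, and the result is pushed forward.
  \<open>h w\<close> and \<open>h v\<close> are similar because they share images with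
  \<open>a\<close> and \<open>b\<close>. Only tuples containing \<open>w\<close> or \<open>v\<close>
  matter, so at most \<open>k + 1\<close> elements are pulled back.\<close>

lemma similar_transfer:
  fixes M :: "'a fo_struct" and N :: "'b fo_struct"
  assumes iso: "\<And>P. P \<subseteq> r \<Longrightarrow> (\<And>a b c d. (a, b) \<in> P \<Longrightarrow> (c, d) \<in> P \<Longrightarrow> a = c \<longleftrightarrow> b = d) \<Longrightarrow>
      partial_iso L M N P"
    and embed: "\<And>B. B \<subseteq> universe N \<Longrightarrow> finite B \<Longrightarrow> card B \<le> k + 1 \<Longrightarrow>
      \<exists>h. inj_on h B \<and> (\<forall>w\<in>B. (h w, w) \<in> r)"
    and col: "\<And>a b w. (a, w) \<in> r \<Longrightarrow> (b, w) \<in> r \<Longrightarrow> (a, b) \<in> similar L M"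
    and arity: "\<And>i. i < length L \<Longrightarrow> L ! i \<le> k"
    and r: "r \<subseteq> universe M \<times> universe N"
    and ab: "(a, w) \<in> r" "(b, v) \<in> r" "(a, b) \<in> similar L M"
  shows "(w, v) \<in> similar L N"
proof (rule similarI)
  show wv: "w \<in> universe N" "v \<in> universe N" using ab r by auto
  fix i xs assume xs: "i < length L" "length xs = L ! i" "set xs \<subseteq> universe N"
  show "interp N i xs = interp N i (map (transpose w v) xs)"
  proof (cases "w \<in> set xs \<or> v \<in> set xs")
    case False
    then have "map (transpose w v) xs = xs" by (auto intro!: map_idI simp: transpose_def)
    then show ?thesis by simp
  next
    case True
    define B where "B = set xs \<union> {w, v}"
    have "card B \<le> card (set xs) + 1"
    proof -
      have "B = insert w (set xs) \<or> B = insert v (set xs)" using True by (auto simp: B_def)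
      then show ?thesis by (auto simp: card_insert_if)
    qed
    then have "card B \<le> k + 1" using card_length[of xs] arity[OF xs(1)] xs(2) by linarith
    then obtain h where h: "inj_on h B" "\<And>x. x \<in> B \<Longrightarrow> (h x, x) \<in> r"
    proof -
      have "B \<subseteq> universe N" "finite B" using xs(3) wv by (auto simp: B_def)
      then show thesis using embed[of B] that \<open>card B \<le> k + 1\<close> by blast
    qed
    have eq: "interp M i (map h ys) = interp N i ys" if ys: "length ys = L ! i" "set ys \<subseteq> B" for ys
    proof -
      have "partial_iso L M N ((\<lambda>x. (h x, x)) ` B)"
        using h by (intro iso) (auto dest: inj_onD)
      then have "interp M i (map fst (map (\<lambda>x. (h x, x)) ys)) = interp N i (map snd (map (\<lambda>x. (h x, x)) ys))"
        by (rule partial_iso_rel) (use ys xs in auto)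
      then show ?thesis by (simp add: comp_def)
    qed
    have B: "set xs \<subseteq> B" "w \<in> B" "v \<in> B" by (auto simp: B_def)
    have tB: "set (map (transpose w v) xs) \<subseteq> B" using B by (auto simp: transpose_def)
    have "(h w, a) \<in> similar L M" "(b, h v) \<in> similar L M" using h(2) B ab col by blast+
    then have sim: "(h w, h v) \<in> similar L M"
      using ab(3) equiv_similar[of M L] by (meson equiv_def transD)
    have "interp N i xs = interp M i (map h xs)" using eq xs(2) B(1) by simp
    also have "\<dots> = interp M i (map (transpose (h w) (h v)) (map h xs))"
      by (rule similar_rel[OF sim xs(1), symmetric]) (use xs(2) h(2) B r in auto)
    also have "\<dots> = interp M i (map h (map (transpose w v) xs))"
      by (simp only: map_transpose_inj_on[OF h(1) B])
    also have "\<dots> = interp N i (map (transpose w v) xs)" by (rule eq[OF _ tB]) (simp add: xs(2))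
    finally show ?thesis .
  qed
qed

text \<open>The Spoiler selects \<open>s + 1\<close> elements of \<open>S\<close>. Were two answers
  dissimilar, a witnessing tuple would contain one of them, so he can switch and select its at most
  \<open>k - 1\<close> other entries. The rounds add up to \<open>(s + 1) + (k - 1)\<close>.\<close>

lemma similar_set_survives:
  fixes M :: "'a fo_struct" and N :: "'b fo_struct"
  assumes ne: "universe M \<noteq> {}" "universe N \<noteq> {}"
    and arity: "\<And>i. i < length L \<Longrightarrow> L ! i \<le> k" "0 < k"
    and surv: "survives_alt L M N (s + k) {}"
    and S: "S \<subseteq> universe M" "s < card S" "\<And>a b. a \<in> S \<Longrightarrow> b \<in> S \<Longrightarrow> (a, b) \<in> similar L M"
  obtains T where "T \<subseteq> universe N" "card T = Suc s"
    "\<And>w v. w \<in> T \<Longrightarrow> v \<in> T \<Longrightarrow> (w, v) \<in> similar L N"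
proof -
  obtain S' where S': "S' \<subseteq> S" "card S' = Suc s" "finite S'"
    using obtain_subset_with_card_n[of "Suc s" S] S(2) by auto
  have "card S' + (k - 1) \<le> s + k" using S'(2) arity(2) by simp
  then obtain Q where Q: "Q \<subseteq> universe M \<times> universe N" "S' \<subseteq> Domain Q" "survives_alt L M N (k - 1) Q"
    using survives_alt_moves[OF ne(1,2) S'(3) _ _ surv] S'(1) S(1) by (metis Un_empty_left subset_trans)
  have isoQ: "partial_iso L M N Q"
    using survives_imp_partial_iso[OF ne(1) survives_alt_same[OF Q(3)]] .
  have "\<forall>a\<in>S'. \<exists>w. (a, w) \<in> Q" using Q(2) by blast
  from bchoice[OF this] obtain g where g: "\<And>a. a \<in> S' \<Longrightarrow> (a, g a) \<in> Q" by blast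
  have "inj_on g S'" using partial_iso_eq[OF isoQ g g] by (intro inj_onI) blast
  then have "card (g ` S') = Suc s" using S'(2) by (simp add: card_image)
  moreover have "g ` S' \<subseteq> universe N" using g Q(1) by blast
  moreover have "(g a, g b) \<in> similar L N" if ab: "a \<in> S'" "b \<in> S'" for a b
  proof (rule similarI)
    show wv: "g a \<in> universe N" "g b \<in> universe N" using ab g Q(1) by blast+
    fix i xs assume xs: "i < length L" "length xs = L ! i" "set xs \<subseteq> universe N"
    let ?w = "g a" and ?v = "g b"
    show "interp N i xs = interp N i (map (transpose ?w ?v) xs)"
    proof (cases "?w \<in> set xs \<or> ?v \<in> set xs")
      case False
      then have "map (transpose ?w ?v) xs = xs" by (auto intro!: map_idI simp: transpose_def)
      then show ?thesis by simp
    next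
      case True
      define U where "U = set xs - {?w, ?v}"
      have "card U < card (set xs)" using True by (intro psubset_card_mono) (auto simp: U_def)
      then have "card U + 0 \<le> k - 1" using card_length[of xs] arity(1)[OF xs(1)] xs(2) by linarith
      moreover have "survives L N M (k - 1) (Q\<inverse>)" by (rule survives_alt_switch[OF Q(3)])
      moreover have "finite U" "U \<subseteq> universe N" using xs(3) by (auto simp: U_def)
      ultimately obtain Q2 where Q2: "Q\<inverse> \<subseteq> Q2" "Q2 \<subseteq> Q\<inverse> \<union> universe N \<times> universe M" "U \<subseteq> Domain Q2"
        "survives L N M 0 Q2"
        using survives_moves[OF ne(2)] by metis
      have iso2: "partial_iso L N M Q2" using Q2(4) by simp
      define B where "B = set xs \<union> {?w, ?v}"
      have wv2: "(?w, a) \<in> Q2" "(?v, b) \<in> Q2" using g ab Q2(1) by blast+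
      have "\<forall>x\<in>B. \<exists>y. (x, y) \<in> Q2" using Q2(3) wv2 by (auto simp: B_def U_def)
      from bchoice[OF this] obtain f where f: "\<And>x. x \<in> B \<Longrightarrow> (x, f x) \<in> Q2" by blast
      have B: "set xs \<subseteq> B" "?w \<in> B" "?v \<in> B" by (auto simp: B_def)
      \<comment> \<open>\<open>f\<close> is an arbitrary choice of partners; their uniqueness forces
        it to return \<open>a\<close> and \<open>b\<close> here.\<close>
      have fw: "f ?w = a" "f ?v = b"
        using partial_iso_eq[OF iso2 f[OF B(2)] wv2(1)] partial_iso_eq[OF iso2 f[OF B(3)] wv2(2)]
        by simp_all
      have inj: "inj_on f B" using partial_iso_eq[OF iso2 f f] by (intro inj_onI) blast
      have fM: "f x \<in> universe M" if "x \<in> B" for x using f[OF that] Q2(2) Q(1) by blast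
      have eq: "interp N i ys = interp M i (map f ys)" if ys: "length ys = L ! i" "set ys \<subseteq> B" for ys
      proof -
        have "interp N i (map fst (map (\<lambda>x. (x, f x)) ys)) = interp M i (map snd (map (\<lambda>x. (x, f x)) ys))"
          by (rule partial_iso_rel[OF iso2 xs(1)]) (use ys f in auto)
        then show ?thesis by (simp add: comp_def)
      qed
      have sim: "(a, b) \<in> similar L M" using S(3) S'(1) ab by blast
      have tB: "set (map (transpose ?w ?v) xs) \<subseteq> B" using B by (auto simp: transpose_def)
      have "interp N i xs = interp M i (map f xs)" using eq xs(2) B(1) by simp
      also have "\<dots> = interp M i (map (transpose a b) (map f xs))"
        by (rule similar_rel[OF sim xs(1), symmetric]) (use xs(2) fM B in auto)
      also have "\<dots> = interp M i (map f (map (transpose ?w ?v) xs))"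
        by (simp only: map_transpose_inj_on[OF inj B] fw)
      also have "\<dots> = interp N i (map (transpose ?w ?v) xs)"
        by (rule eq[OF _ tB, symmetric]) (simp add: xs(2))
      finally show ?thesis .
    qed
  qed
  ultimately show thesis using that[of "g ` S'"] by blast
qed

text \<open>The position after the Spoiler has selected \<open>X\<close>, with the structure for the
  remaining \<open>left\<close> rounds still open. Of these, \<open>(k - 1) * (k - 1)\<close> are
  held back for punishing violations of the forced matching; \<open>k + 1\<close> plus half the
  number of remaining elements suffice to display one element more than a set of at most
  \<open>card Z div 2 + k\<close> elements has.\<close>

locale base_position = bounded_arity_struct L M k
  for L :: vocabulary and M :: "'a fo_struct" and k :: nat +
  fixes N :: "'b fo_struct" and X :: "'a set" and Ys :: "nat \<Rightarrow> 'a set"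
    and P0 :: "('a \<times> 'b) set" and left :: nat
  assumes base: "layered_base (k - 1) X Ys"
    and finite_N: "finite (universe N)" and nonempty: "universe M \<noteq> {}" "universe N \<noteq> {}"
    and P0: "P0 \<subseteq> universe M \<times> universe N" "Domain P0 = X"
    and survives_left: "survives L M N left P0" and survives_right: "survives L N M left (P0\<inverse>)"
    and rounds: "(k - 1) * (k - 1) + k + 1 + card (universe M - (X \<union> Ys (k - 1))) div 2 \<le> left"
begin

abbreviation W where "W \<equiv> universe N"

text \<open>The Spoiler has now settled in one structure; the disjunction leaves open which, so that
  later arguments treat both sides together.\<close>

definition holds :: "nat \<Rightarrow> ('a \<times> 'b) set \<Rightarrow> bool" where
  "holds d Q \<longleftrightarrow> P0 \<subseteq> Q \<and> Q \<subseteq> V \<times> W \<and> (survives L M N d Q \<or> survives L N M d (Q\<inverse>))"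

lemma holds_partial_iso: "holds d Q \<Longrightarrow> partial_iso L M N Q"
  unfolding holds_def
  using survives_imp_partial_iso[OF nonempty(1)] survives_imp_partial_iso[OF nonempty(2), of L M d "Q\<inverse>"]
  by auto

lemma holds_antimono: "holds d Q \<Longrightarrow> d' \<le> d \<Longrightarrow> holds d' Q"
  unfolding holds_def using survives_antimono[OF nonempty(1)] survives_antimono[OF nonempty(2)] by blast

lemma pick_left:
  assumes "A \<subseteq> V" "card A + d \<le> left"
  obtains Q where "holds d Q" "A \<subseteq> Domain Q"
proof -
  have "finite A" by (rule finite_subset[OF assms(1) finite_universe])
  then obtain Q where "P0 \<subseteq> Q" "Q \<subseteq> P0 \<union> V \<times> W" "A \<subseteq> Domain Q" "survives L M N d Q"
    using survives_moves[OF nonempty(1) _ assms survives_left] by blast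
  then show thesis using that[of Q] P0(1) by (auto simp: holds_def)
qed

lemma pick_right:
  assumes "B \<subseteq> W" "card B + d \<le> left"
  obtains Q where "holds d Q" "B \<subseteq> Range Q"
proof -
  have "finite B" by (rule finite_subset[OF assms(1) finite_N])
  then obtain Q where Q: "P0\<inverse> \<subseteq> Q" "Q \<subseteq> P0\<inverse> \<union> W \<times> V" "B \<subseteq> Domain Q" "survives L N M d Q"
    using survives_moves[OF nonempty(2) _ assms survives_right] by blast
  have "holds d (Q\<inverse>)" using Q P0(1) by (auto simp: holds_def)
  moreover have "B \<subseteq> Range (Q\<inverse>)" using Q(3) by auto
  ultimately show thesis by (rule that)
qed

text \<open>The Spoiler can only select components lying in the structure he has settled in, so he
  covers either all first or all second components of \<open>B\<close>.\<close>

lemma pick_pairs: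
  assumes "holds (c + d) Q" "B \<subseteq> V \<times> W" "finite B" "card B \<le> c"
  obtains Q' where "Q \<subseteq> Q'" "holds d Q'"
    "(\<forall>p\<in>B. \<exists>w. (fst p, w) \<in> Q') \<or> (\<forall>p\<in>B. \<exists>a. (a, snd p) \<in> Q')"
proof -
  have Q: "P0 \<subseteq> Q" "Q \<subseteq> V \<times> W" using assms(1) by (auto simp: holds_def)
  consider "survives L M N (c + d) Q" | "survives L N M (c + d) (Q\<inverse>)"
    using assms(1) by (auto simp: holds_def)
  then show thesis
  proof cases
    case 1
    have "card (fst ` B) + d \<le> c + d" using card_image_le[OF assms(3), of fst] assms(4) by simp
    moreover have "fst ` B \<subseteq> V" "finite (fst ` B)" using assms(2,3) by auto
    ultimately obtain Q' where Q': "Q \<subseteq> Q'" "Q' \<subseteq> Q \<union> V \<times> W" "fst ` B \<subseteq> Domain Q'" "survives L M N d Q'"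
      using survives_moves[OF nonempty(1), of "fst ` B"] 1 by metis
    then have "holds d Q'" using Q by (auto simp: holds_def)
    moreover have "\<forall>p\<in>B. \<exists>w. (fst p, w) \<in> Q'" using Q'(3) by blast
    ultimately show thesis using that Q'(1) by blast
  next
    case 2
    have "card (snd ` B) + d \<le> c + d" using card_image_le[OF assms(3), of snd] assms(4) by simp
    moreover have "snd ` B \<subseteq> W" "finite (snd ` B)" using assms(2,3) by auto
    ultimately obtain Q' where Q': "Q\<inverse> \<subseteq> Q'" "Q' \<subseteq> Q\<inverse> \<union> W \<times> V" "snd ` B \<subseteq> Domain Q'" "survives L N M d Q'"
      using survives_moves[OF nonempty(2), of "snd ` B"] 2 by metis
    then have "holds d (Q'\<inverse>)" using Q by (auto simp: holds_def)
    moreover have "\<forall>p\<in>B. \<exists>a. (a, snd p) \<in> Q'\<inverse>" using Q'(3) by blast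
    moreover have "Q \<subseteq> Q'\<inverse>" using Q'(1) by auto
    ultimately show thesis using that by blast
  qed
qed

text \<open>
  \<open>F\<close> is the forced matching of the first \<open>i\<close> layers: a Duplicator who can still answer
  \<open>(k - 1) * i\<close> moves has violated it nowhere.
\<close>

definition forced_matching :: "nat \<Rightarrow> ('a \<times> 'b) set \<Rightarrow> bool" where
  "forced_matching i F \<longleftrightarrow> P0 \<subseteq> F \<and> F \<subseteq> V \<times> W \<and> Domain F = X \<union> Ys i \<and> partial_iso L M N F \<and>
     (\<forall>Q p. holds ((k - 1) * i) Q \<and> p \<in> Q \<longrightarrow> partial_iso L M N (insert p F))"

lemma base_sets: "X \<subseteq> V" "Ys (k - 1) \<subseteq> V" "X \<inter> Ys (k - 1) = {}" "Ys 0 = {}"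
  using base by (auto simp: layered_base_def)

lemma base_unique:
  "i < k - 1 \<Longrightarrow> (a, y) \<in> same_type (X \<union> Ys i) \<Longrightarrow> y \<in> Ys (Suc i) \<Longrightarrow> a = y"
  using base by (simp add: layered_base_def)

lemma Ys_subset: "i \<le> k - 1 \<Longrightarrow> Ys i \<subseteq> Ys (k - 1)"
proof (induction rule: inc_induct)
  case (step i)
  then show ?case using base unfolding layered_base_def by (meson subset_trans)
qed simp

text \<open>Going from \<open>a\<close> to the common image \<open>w\<close> and back to
  \<open>b\<close> gives a partial automorphism that fixes the domain of \<open>F\<close>.\<close>

lemma partial_iso_common_image:
  assumes "partial_iso L M N (insert (a, w) F)" "partial_iso L M N (insert (b, w) F)"
    "a \<in> V - Domain F" "b \<in> V - Domain F"
  shows "(a, b) \<in> same_type (Domain F)"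
proof -
  have "partial_iso L M M (insert (a, w) F O (insert (b, w) F)\<inverse>)"
    using assms(1,2) by (intro partial_iso_comp) (simp_all only: partial_iso_converse)
  moreover have "insert (a, b) (Id_on (Domain F)) \<subseteq> insert (a, w) F O (insert (b, w) F)\<inverse>"
    by auto
  ultimately show ?thesis using assms(3,4) by (auto simp: same_type_def intro: partial_iso_subset)
qed

lemma forced_matching_0: "forced_matching 0 P0"
proof -
  have "partial_iso L M N P0" by (rule survives_imp_partial_iso[OF nonempty(1) survives_left])
  moreover have "partial_iso L M N (insert p P0)" if "holds 0 Q" "p \<in> Q" for Q p
    using holds_partial_iso[OF that(1)] that by (auto simp: holds_def intro: partial_iso_subset)
  ultimately show ?thesis using P0 base_sets by (auto simp: forced_matching_def)
qed

text \<open>\<open>G\<close> pairs the elements of \<open>X\<close> and the layers up to the next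
  one with everything that \<open>F\<close> does not exclude. It is a matching because layer
  elements are unique of their type (\<open>D2\<close>), and because two images of one element, when
  selected by the Spoiler, would both have to be answered by it (\<open>D1\<close>). A violating
  tuple involves at most \<open>k - 1\<close> pairs of \<open>G\<close> besides the new pair;
  selecting one side of these brings all of them into play, which is why a layer costs
  \<open>k - 1\<close> moves.\<close>

lemma forced_matching_Suc:
  assumes i: "i < k - 1" and F: "forced_matching i F"
  shows "\<exists>F'. forced_matching (Suc i) F'"
proof -
  let ?d = "(k - 1) * i"
  have F': "P0 \<subseteq> F" "F \<subseteq> V \<times> W" "Domain F = X \<union> Ys i" "partial_iso L M N F"
    and forced: "\<And>Q p. holds ?d Q \<Longrightarrow> p \<in> Q \<Longrightarrow> partial_iso L M N (insert p F)"
    using F by (auto simp: forced_matching_def)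
  have budget: "k + ?d \<le> left"
  proof -
    have "(k - 1) * Suc i \<le> (k - 1) * (k - 1)" using i by (intro mult_le_mono2) simp
    then have "k - 1 + ?d \<le> (k - 1) * (k - 1)" by (simp only: mult_Suc_right)
    then show ?thesis using rounds by linarith
  qed
  have E: "X \<union> Ys (Suc i) \<subseteq> V" "X \<union> Ys i \<subseteq> X \<union> Ys (Suc i)"
    using base_sets Ys_subset[of "Suc i"] i base by (auto simp: layered_base_def)
  have D2: "y = y'"
    if y: "y \<in> X \<union> Ys (Suc i)" "y' \<in> V" "partial_iso L M N (insert (y, v) F)"
      "partial_iso L M N (insert (y', v) F)" for y y' v
  proof (cases "y \<in> Domain F \<or> y' \<in> Domain F")
    case True
    then have "(y, v) \<in> F \<or> (y', v) \<in> F"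
      using partial_iso_eq[OF y(3)] partial_iso_eq[OF y(4)] by (metis DomainE insertCI)
    then show ?thesis
      using partial_iso_eq[OF y(3)] partial_iso_eq[OF y(4)] by (metis insertCI)
  next
    case False
    then have "(y', y) \<in> same_type (X \<union> Ys i)"
      using partial_iso_common_image[OF y(4,3)] y(1,2) E F'(3) by auto
    moreover have "y \<in> Ys (Suc i)" using False y(1) F'(3) by auto
    ultimately show ?thesis using base_unique[OF i] by blast
  qed
  have D1: "v = v'"
    if y: "y \<in> X \<union> Ys (Suc i)" "v \<in> W" "v' \<in> W" "partial_iso L M N (insert (y, v) F)"
      "partial_iso L M N (insert (y, v') F)" for y v v'
  proof -
    have "card {v, v'} \<le> 2" by (simp add: card_insert_if)
    then have "card {v, v'} + ?d \<le> left" using budget i by linarith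
    then obtain Q where Q: "holds ?d Q" "{v, v'} \<subseteq> Range Q"
      using pick_right[of "{v, v'}" ?d] y by blast
    then obtain a a' where a: "(a, v) \<in> Q" "(a', v') \<in> Q" by blast
    have "a \<in> V" "a' \<in> V" using Q(1) a by (auto simp: holds_def)
    then have "y = a" "y = a'" using D2 y forced[OF Q(1) a(1)] forced[OF Q(1) a(2)] by blast+
    then show ?thesis using partial_iso_eq[OF holds_partial_iso[OF Q(1)] a] by simp
  qed
  define G where "G = {(y, v). y \<in> X \<union> Ys (Suc i) \<and> v \<in> W \<and> partial_iso L M N (insert (y, v) F)}"
  \<comment> \<open>Selecting either component of a pair in \<open>G\<close> forces the other: the
    answer is compatible with \<open>F\<close>, so by \<open>D1\<close> or \<open>D2\<close> it is
    the prescribed one.\<close>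
  have in_Q: "B \<subseteq> Q" if "B \<subseteq> G" and Q: "holds ?d Q"
    "(\<forall>p\<in>B. \<exists>w. (fst p, w) \<in> Q) \<or> (\<forall>p\<in>B. \<exists>a. (a, snd p) \<in> Q)" for B Q
  proof
    fix p assume p: "p \<in> B"
    obtain y v where yv: "p = (y, v)" by (cases p)
    have G: "y \<in> X \<union> Ys (Suc i)" "v \<in> W" "partial_iso L M N (insert (y, v) F)"
      using p \<open>B \<subseteq> G\<close> yv by (auto simp: G_def)
    consider w where "(y, w) \<in> Q" | a where "(a, v) \<in> Q" using Q(2) p yv by fastforce
    then show "p \<in> Q"
    proof cases
      case 1
      then have "w = v" using D1[of y w v] G forced[OF Q(1) 1] Q(1) by (auto simp: holds_def)
      with 1 yv show ?thesis by simp
    next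
      case 2
      then have "y = a" using D2[of y a v] G forced[OF Q(1) 2] Q(1) by (auto simp: holds_def)
      with 2 yv show ?thesis by simp
    qed
  qed
  have GV: "G \<subseteq> V \<times> W" using E by (auto simp: G_def)
  have FG: "F \<subseteq> G" using F' E(2) by (auto simp: G_def insert_absorb)
  have isoG: "partial_iso L M N G"
  proof (rule partial_isoI)
    fix a c :: 'a and v w :: 'b
    assume "(a, v) \<in> G" "(c, w) \<in> G"
    then show "a = c \<longleftrightarrow> v = w" using D1 D2 E unfolding G_def by blast
  next
    fix l ps assume ps: "l < length L" "length ps = L ! l" "set ps \<subseteq> G"
    have "card (fst ` set ps) \<le> length ps"
      by (metis card_image_le card_length finite_set le_trans)
    then have "card (fst ` set ps) + ?d \<le> left" using budget arity_le[OF ps(1)] ps(2) by linarith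
    moreover have "fst ` set ps \<subseteq> V" using ps(3) GV by auto
    ultimately obtain Q where Q: "holds ?d Q" "fst ` set ps \<subseteq> Domain Q" using pick_left by blast
    then have "set ps \<subseteq> Q" by (intro in_Q[OF ps(3)]) auto
    then show "interp M l (map fst ps) = interp N l (map snd ps)"
      using partial_iso_rel[OF holds_partial_iso[OF Q(1)]] ps by blast
  qed
  have "forced_matching (Suc i) G"
    unfolding forced_matching_def
  proof (intro conjI allI impI)
    show "P0 \<subseteq> G" using F' FG by blast
    show "G \<subseteq> V \<times> W" by (rule GV)
    show "partial_iso L M N G" by (rule isoG)
    show "Domain G = X \<union> Ys (Suc i)"
    proof
      show "Domain G \<subseteq> X \<union> Ys (Suc i)" by (auto simp: G_def)
      show "X \<union> Ys (Suc i) \<subseteq> Domain G"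
      proof
        fix y assume y: "y \<in> X \<union> Ys (Suc i)"
        have "card {y} + ?d \<le> left" using budget k_pos by simp
        then obtain Q where Q: "holds ?d Q" "{y} \<subseteq> Domain Q" using pick_left[of "{y}"] y E by blast
        then obtain w where w: "(y, w) \<in> Q" by blast
        then have "(y, w) \<in> G" using forced[OF Q(1) w] y Q(1) by (auto simp: G_def holds_def)
        then show "y \<in> Domain G" by blast
      qed
    qed
    fix Q p assume asm: "holds ((k - 1) * Suc i) Q \<and> p \<in> Q"
    then have Q: "holds ((k - 1) + ?d) Q" "p \<in> Q" by simp_all
    obtain a w where p: "p = (a, w)" by (cases p)
    have aw: "a \<in> V" "w \<in> W" using Q p by (auto simp: holds_def)
    have isop: "partial_iso L M N (insert (a, w) F)"
      using forced[OF holds_antimono[OF Q(1)] Q(2)] p by simp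
    have key: "a = y \<longleftrightarrow> w = v" if "(y, v) \<in> G" for y v
    proof -
      have G: "y \<in> X \<union> Ys (Suc i)" "v \<in> W" "partial_iso L M N (insert (y, v) F)"
        using that by (auto simp: G_def)
      show ?thesis using D1[of y w v] D2[of y a v] G isop aw by blast
    qed
    show "partial_iso L M N (insert p G)"
    proof (rule partial_isoI)
      show "x = x' \<longleftrightarrow> v = v'" if "(x, v) \<in> insert p G" "(x', v') \<in> insert p G" for x v x' v'
        using that key partial_iso_eq[OF isoG] unfolding p by blast
    next
      fix l ps assume ps: "l < length L" "length ps = L ! l" "set ps \<subseteq> insert p G"
      show "interp M l (map fst ps) = interp N l (map snd ps)"
      proof (cases "p \<in> set ps")
        case False
        then show ?thesis using partial_iso_rel[OF isoG ps(1,2)] ps(3) by blast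
      next
        case True
        let ?B = "set ps - {p}"
        have "card ?B < card (set ps)" using True by (intro psubset_card_mono) auto
        then have c: "card ?B \<le> k - 1" using card_length[of ps] arity_le[OF ps(1)] ps(2) by linarith
        have BG: "?B \<subseteq> G" using ps(3) by auto
        then have BV: "?B \<subseteq> V \<times> W" using GV by blast
        obtain Q' where Q': "Q \<subseteq> Q'" "holds ?d Q'"
          "(\<forall>p\<in>?B. \<exists>w. (fst p, w) \<in> Q') \<or> (\<forall>p\<in>?B. \<exists>a. (a, snd p) \<in> Q')"
          using pick_pairs[OF Q(1) BV _ c] by blast
        have "?B \<subseteq> Q'" by (rule in_Q[OF BG Q'(2,3)])
        then have "set ps \<subseteq> Q'" using Q(2) Q'(1) by auto
        then show ?thesis
          using partial_iso_rel[OF holds_partial_iso[OF Q'(2)]] ps by blast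
      qed
    qed
  qed
  then show ?thesis by blast
qed

lemma ex_forced_matching: "i \<le> k - 1 \<Longrightarrow> \<exists>F. forced_matching i F"
proof (induction i)
  case 0
  then show ?case using forced_matching_0 by blast
next
  case (Suc i)
  then show ?case using forced_matching_Suc by auto
qed

end


subsection \<open>Matching the remaining elements\<close>

context base_position
begin

context
  fixes F :: "('a \<times> 'b) set"
  assumes F: "forced_matching (k - 1) F"
begin

abbreviation E where "E \<equiv> X \<union> Ys (k - 1)"

abbreviation reserve where "reserve \<equiv> (k - 1) * (k - 1)"

text \<open>The pairs not refuted by the forced matching. An answer outside this relation costs the
  Duplicator the game within \<open>reserve\<close> further moves.\<close>

definition candidates :: "('a \<times> 'b) set" where
  "candidates = {(a, w). a \<in> V \<and> w \<in> W \<and> partial_iso L M N (insert (a, w) F)}"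

lemma candidates_subset: "candidates \<subseteq> V \<times> W"
  by (auto simp: candidates_def)

lemma Domain_F: "Domain F = E"
  using F by (simp add: forced_matching_def)

lemma holds_candidates:
  assumes Q: "holds reserve Q"
  shows "Q \<subseteq> candidates"
proof
  fix p assume p: "p \<in> Q"
  then have "partial_iso L M N (insert p F)" using F Q unfolding forced_matching_def by blast
  moreover have "p \<in> V \<times> W" using p Q by (auto simp: holds_def)
  ultimately show "p \<in> candidates" by (auto simp: candidates_def)
qed

text \<open>Send \<open>b\<close> to \<open>x\<close>, back to \<open>a\<close> and on to
  \<open>y\<close>; along the same path every pair of \<open>F\<close> is reproduced.\<close>

lemma candidates_difunctional:
  assumes "(a, x) \<in> candidates" "(b, x) \<in> candidates" "(a, y) \<in> candidates"
  shows "(b, y) \<in> candidates"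
proof -
  have "partial_iso L M N (insert (b, x) F O (insert (a, x) F)\<inverse> O insert (a, y) F)"
    using assms by (intro partial_iso_comp) (simp_all only: partial_iso_converse, auto simp: candidates_def)
  moreover have "insert (b, y) F \<subseteq> insert (b, x) F O (insert (a, x) F)\<inverse> O insert (a, y) F"
    by auto
  ultimately show ?thesis using assms by (auto simp: candidates_def intro: partial_iso_subset)
qed

lemma candidates_left_total: "a \<in> V \<Longrightarrow> \<exists>w. (a, w) \<in> candidates"
proof -
  assume a: "a \<in> V"
  have "card {a} + reserve \<le> left" using rounds by simp
  then obtain Q where "holds reserve Q" "{a} \<subseteq> Domain Q" using pick_left[of "{a}"] a by blast
  then show ?thesis using holds_candidates by blast
qed

lemma candidates_right_total: "w \<in> W \<Longrightarrow> \<exists>a. (a, w) \<in> candidates"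
proof -
  assume w: "w \<in> W"
  have "card {w} + reserve \<le> left" using rounds by simp
  then obtain Q where "holds reserve Q" "{w} \<subseteq> Range Q" using pick_right[of "{w}"] w by blast
  then show ?thesis using holds_candidates by blast
qed

lemma candidates_base:
  assumes "(a, w) \<in> candidates" "(b, w) \<in> candidates" "a \<in> E"
  shows "a = b"
proof -
  have iso: "partial_iso L M N (insert (a, w) F)" "partial_iso L M N (insert (b, w) F)"
    using assms by (auto simp: candidates_def)
  obtain v where v: "(a, v) \<in> F" using assms(3) Domain_F by blast
  then have "(a, w) \<in> F" using partial_iso_eq[OF iso(1), of a w a v] by auto
  then show ?thesis using partial_iso_eq[OF iso(2), of a w b w] by auto
qed

lemma candidates_similar:
  assumes "(a, w) \<in> candidates" "(b, w) \<in> candidates"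
  shows "(a, b) \<in> similar L M"
proof (cases "a \<in> E \<or> b \<in> E")
  case True
  then have "a = b" using candidates_base assms by blast
  then show ?thesis
    using assms candidates_subset equiv_similar[of M L] by (auto simp: equiv_def refl_on_def)
next
  case False
  have "(a, b) \<in> same_type (Domain F)"
  proof (rule partial_iso_common_image)
    show "partial_iso L M N (insert (a, w) F)" "partial_iso L M N (insert (b, w) F)"
      using assms by (auto simp: candidates_def)
    show "a \<in> V - Domain F" "b \<in> V - Domain F"
      using assms candidates_subset False Domain_F by auto
  qed
  then show ?thesis unfolding Domain_F by (rule layered_base_similar[OF base])
qed

text \<open>Let the Spoiler select the second components of a tuple of pairs. Each answer shares its
  image with the given first component and is therefore similar to it; replacing elements
  injectively by similar ones does not affect relations, by
  \<open>similar_image_rel\<close>.\<close>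

lemma candidates_partial_iso:
  assumes P: "P \<subseteq> candidates"
    and bij: "\<And>a b c d. (a, b) \<in> P \<Longrightarrow> (c, d) \<in> P \<Longrightarrow> a = c \<longleftrightarrow> b = d"
  shows "partial_iso L M N P"
proof (rule partial_isoI, rule bij)
  fix i ps assume ps: "i < length L" "length ps = L ! i" "set ps \<subseteq> P"
  have psVW: "set ps \<subseteq> V \<times> W" using ps(3) P candidates_subset by blast
  have "card (snd ` set ps) \<le> length ps"
    by (rule order_trans[OF card_image_le card_length]) simp
  then have "card (snd ` set ps) + reserve \<le> left"
    using rounds arity_le[OF ps(1)] ps(2) by linarith
  moreover have "snd ` set ps \<subseteq> W" using psVW by auto
  ultimately obtain Q where Q: "holds reserve Q" "snd ` set ps \<subseteq> Range Q" using pick_right by blast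
  have isoQ: "partial_iso L M N Q" by (rule holds_partial_iso[OF Q(1)])
  have "\<forall>v\<in>snd ` set ps. \<exists>a. (a, v) \<in> Q" using Q(2) by blast
  from bchoice[OF this] obtain g where g: "\<And>v. v \<in> snd ` set ps \<Longrightarrow> (g v, v) \<in> Q" by blast
  have "\<forall>a\<in>fst ` set ps. \<exists>v. (a, v) \<in> set ps" by force
  from bchoice[OF this] obtain f where f: "\<And>a. a \<in> fst ` set ps \<Longrightarrow> (a, f a) \<in> set ps" by blast
  have f_eq: "f (fst p) = snd p" if p: "p \<in> set ps" for p
  proof -
    have "(fst p, f (fst p)) \<in> P" "(fst p, snd p) \<in> P" using f p ps(3) by auto
    then show ?thesis using bij by blast
  qed
  have snd_f: "f a \<in> snd ` set ps" if "a \<in> fst ` set ps" for a using f[OF that] by force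
  have "interp M i (map (g \<circ> f) (map fst ps)) = interp M i (map fst ps)"
  proof (rule similar_image_rel[where A = "fst ` set ps"])
    show "fst ` set ps \<subseteq> V" using psVW by auto
    show "inj_on (g \<circ> f) (fst ` set ps)"
    proof (rule inj_onI)
      fix a c assume ac: "a \<in> fst ` set ps" "c \<in> fst ` set ps" "(g \<circ> f) a = (g \<circ> f) c"
      then have "f a = f c"
        using partial_iso_eq[OF isoQ g[OF snd_f[OF ac(1)]] g[OF snd_f[OF ac(2)]]] by simp
      moreover have "(a, f a) \<in> P" "(c, f c) \<in> P" using f ac ps(3) by blast+
      ultimately show "a = c" using bij by blast
    qed
    fix a assume a: "a \<in> fst ` set ps"
    have "(a, f a) \<in> candidates" using f[OF a] ps(3) P by blast
    moreover have "(g (f a), f a) \<in> candidates"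
      using g[OF snd_f[OF a]] holds_candidates[OF Q(1)] by blast
    ultimately show "(a, (g \<circ> f) a) \<in> similar L M" using candidates_similar by simp
  qed (use ps in auto)
  moreover have "map (g \<circ> f) (map fst ps) = map fst (map (\<lambda>p. (g (snd p), snd p)) ps)"
    using f_eq by simp
  moreover have "interp M i (map fst (map (\<lambda>p. (g (snd p), snd p)) ps)) =
      interp N i (map snd (map (\<lambda>p. (g (snd p), snd p)) ps))"
    by (rule partial_iso_rel[OF isoQ ps(1)]) (use ps g in auto)
  moreover have "map snd (map (\<lambda>p. (g (snd p), snd p)) ps) = map snd ps" by simp
  ultimately show "interp M i (map fst ps) = interp N i (map snd ps)" by metis
qed

text \<open>Difunctionality splits \<open>candidates\<close> into disjoint rectangles, each a block
  times the common row of its elements. By \<open>block_eq\<close> the block is also the column of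
  any element of that row.\<close>

definition block :: "'a \<Rightarrow> 'a set" where
  "block a = {b\<in>V. candidates `` {b} = candidates `` {a}}"

lemma candidates_same_row:
  "(a, w) \<in> candidates \<Longrightarrow> (b, w) \<in> candidates \<Longrightarrow> candidates `` {a} = candidates `` {b}"
  by (auto intro: candidates_difunctional)

lemma block_eq: "(a, w) \<in> candidates \<Longrightarrow> candidates\<inverse> `` {w} = block a"
proof
  assume a: "(a, w) \<in> candidates"
  show "candidates\<inverse> `` {w} \<subseteq> block a"
  proof
    fix c assume "c \<in> candidates\<inverse> `` {w}"
    then have c: "(c, w) \<in> candidates" by simp
    then have "c \<in> V" using candidates_subset by blast
    then show "c \<in> block a" unfolding block_def using candidates_same_row[OF c a] by blast
  qed
  show "block a \<subseteq> candidates\<inverse> `` {w}"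
  proof
    fix c assume "c \<in> block a"
    then have "candidates `` {c} = candidates `` {a}" unfolding block_def by blast
    then show "c \<in> candidates\<inverse> `` {w}" using a by blast
  qed
qed

lemma row_eq:
  assumes a: "(a, w) \<in> candidates"
  shows "{v\<in>W. candidates\<inverse> `` {v} = candidates\<inverse> `` {w}} = candidates `` {a}"
proof
  show "{v\<in>W. candidates\<inverse> `` {v} = candidates\<inverse> `` {w}} \<subseteq> candidates `` {a}" using a by blast
  show "candidates `` {a} \<subseteq> {v\<in>W. candidates\<inverse> `` {v} = candidates\<inverse> `` {w}}"
  proof
    fix v assume "v \<in> candidates `` {a}"
    then have v: "(a, v) \<in> candidates" by simp
    then have "v \<in> W" using candidates_subset by blast
    then show "v \<in> {v\<in>W. candidates\<inverse> `` {v} = candidates\<inverse> `` {w}}"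
      using block_eq[OF v] block_eq[OF a] by simp
  qed
qed

section \<open>Injections along the rectangles\<close>

lemma finite_row: "finite (candidates `` {a})"
  by (rule finite_subset[OF _ finite_N]) (use candidates_subset in auto)

lemma finite_col: "finite (candidates\<inverse> `` {w})"
  by (rule finite_subset[OF _ finite_universe]) (use candidates_subset in auto)

lemma ex_injection_left:
  assumes "A \<subseteq> V" "\<And>a. a \<in> A \<Longrightarrow> card (A \<inter> block a) \<le> card (candidates `` {a})"
  obtains h where "inj_on h A" "\<And>a. a \<in> A \<Longrightarrow> (a, h a) \<in> candidates"
proof (rule ex_injection_difunctional[of A candidates])
  show "finite A" by (rule finite_subset[OF assms(1) finite_universe])
  fix a assume "a \<in> A"
  moreover have "{b\<in>A. candidates `` {b} = candidates `` {a}} = A \<inter> block a"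
    using assms(1) by (auto simp: block_def)
  ultimately show "card {b\<in>A. candidates `` {b} = candidates `` {a}} \<le> card (candidates `` {a})"
    using assms(2) by simp
qed (use finite_row candidates_difunctional that in blast)+

lemma ex_injection_right:
  assumes "B \<subseteq> W"
    "\<And>a w. w \<in> B \<Longrightarrow> (a, w) \<in> candidates \<Longrightarrow> card (B \<inter> candidates `` {a}) \<le> card (block a)"
  obtains h where "inj_on h B" "\<And>w. w \<in> B \<Longrightarrow> (h w, w) \<in> candidates"
proof (rule ex_injection_difunctional[of B "candidates\<inverse>"])
  show "finite B" by (rule finite_subset[OF assms(1) finite_N])
  fix w assume w: "w \<in> B"
  then obtain a where a: "(a, w) \<in> candidates" using candidates_right_total assms(1) by blast
  have "{v\<in>B. candidates\<inverse> `` {v} = candidates\<inverse> `` {w}} = B \<inter> candidates `` {a}"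
    using row_eq[OF a] assms(1) by blast
  then show "card {v\<in>B. candidates\<inverse> `` {v} = candidates\<inverse> `` {w}} \<le> card (candidates\<inverse> `` {w})"
    using assms(2)[OF w a] block_eq[OF a] by simp
next
  show "(v, x) \<in> candidates\<inverse> \<Longrightarrow> (w, x) \<in> candidates\<inverse> \<Longrightarrow> (v, y) \<in> candidates\<inverse> \<Longrightarrow>
      (w, y) \<in> candidates\<inverse>" for v w x y
    using candidates_difunctional[of x v y w] by simp
qed (use finite_col that in auto)

text \<open>Equal sides of all rectangles allow injections in both directions, hence a bijection
  inside \<open>candidates\<close>, which is an isomorphism by
  \<open>candidates_partial_iso\<close>.\<close>

lemma isomorphic_if_balanced:
  assumes "\<And>a. a \<in> V \<Longrightarrow> card (block a) = card (candidates `` {a})"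
  shows "isomorphic L M N"
proof -
  obtain h where h: "inj_on h V" "\<And>a. a \<in> V \<Longrightarrow> (a, h a) \<in> candidates"
  proof (rule ex_injection_left[of V])
    fix a assume "a \<in> V"
    moreover have "V \<inter> block a = block a" by (auto simp: block_def)
    ultimately show "card (V \<inter> block a) \<le> card (candidates `` {a})" using assms by simp
  qed auto
  obtain g where g: "inj_on g W" "\<And>w. w \<in> W \<Longrightarrow> (g w, w) \<in> candidates"
  proof (rule ex_injection_right[of W])
    fix a w assume "(a, w) \<in> candidates"
    then have "a \<in> V" "W \<inter> candidates `` {a} = candidates `` {a}" using candidates_subset by auto
    then show "card (W \<inter> candidates `` {a}) \<le> card (block a)" using assms by simp
  qed auto
  have hW: "h ` V \<subseteq> W" using h(2) candidates_subset by auto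
  have "g ` W \<subseteq> V" using g(2) candidates_subset by auto
  then have "card W \<le> card V" by (rule card_inj_on_le[OF g(1) _ finite_universe])
  then have "h ` V = W"
    using h(1) by (intro card_seteq[OF finite_N hW]) (simp add: card_image)
  with h(1) have bij: "bij_betw h V W" by (simp add: bij_betw_def)
  have iso: "partial_iso L M N ((\<lambda>a. (a, h a)) ` V)"
    using h by (intro candidates_partial_iso) (auto simp: inj_on_eq_iff)
  have "interp M i xs = interp N i (map h xs)"
    if "i < length L" "length xs = L ! i" "set xs \<subseteq> V" for i xs
  proof -
    have "interp M i (map fst (map (\<lambda>a. (a, h a)) xs)) = interp N i (map snd (map (\<lambda>a. (a, h a)) xs))"
      by (rule partial_iso_rel[OF iso that(1)]) (use that in auto)
    then show ?thesis by (simp add: comp_def)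
  qed
  with bij show ?thesis unfolding isomorphic_def isomorphism_def by blast
qed

abbreviation Z where "Z \<equiv> V - E"

section \<open>Unbalanced blocks\<close>

context
  fixes a0
  assumes a0: "a0 \<in> V" and unbalanced: "card (block a0) \<noteq> card (candidates `` {a0})"
begin

lemma finite_block: "finite (block a)"
  by (rule finite_subset[OF _ finite_universe]) (auto simp: block_def)

text \<open>Otherwise the Spoiler could afford to select, on the longer side, one element more than
  the shorter side has. The answers are distinct and stay inside the rectangle, which is
  impossible.\<close>

lemma unbalanced_large:
  "card Z div 2 + k < card (block a0)" "card Z div 2 + k < card (candidates `` {a0})"
proof -
  have "card Z div 2 + k < min (card (block a0)) (card (candidates `` {a0}))"
  proof (rule ccontr)
    assume small: "\<not> ?thesis"
    show False
    proof (cases "card (block a0) < card (candidates `` {a0})")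
      case True
      then obtain B where B: "B \<subseteq> candidates `` {a0}" "card B = Suc (card (block a0))"
        using obtain_subset_with_card_n[of "Suc (card (block a0))" "candidates `` {a0}"] by auto
      have BW: "B \<subseteq> W" using B(1) candidates_subset by auto
      have "card B + reserve \<le> left" using rounds small True B(2) by linarith
      then obtain Q where Q: "holds reserve Q" "B \<subseteq> Range Q" using pick_right[OF BW] by blast
      have "\<forall>w\<in>B. \<exists>a. (a, w) \<in> Q" using Q(2) by blast
      from bchoice[OF this] obtain g where g: "\<And>w. w \<in> B \<Longrightarrow> (g w, w) \<in> Q" by blast
      have "inj_on g B"
        using partial_iso_eq[OF holds_partial_iso[OF Q(1)] g g] by (intro inj_onI) blast
      moreover have "g ` B \<subseteq> block a0"
      proof
        fix x assume "x \<in> g ` B"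
        then obtain w where w: "w \<in> B" "x = g w" by blast
        have "(x, w) \<in> candidates" using g[OF w(1)] w(2) holds_candidates[OF Q(1)] by blast
        moreover have "(a0, w) \<in> candidates" using w(1) B(1) by blast
        ultimately show "x \<in> block a0" using block_eq by blast
      qed
      ultimately have "card B \<le> card (block a0)" using finite_block by (rule card_inj_on_le)
      with B(2) show False by simp
    next
      case False
      then have lt: "card (candidates `` {a0}) < card (block a0)" using unbalanced by simp
      then obtain B where B: "B \<subseteq> block a0" "card B = Suc (card (candidates `` {a0}))"
        using obtain_subset_with_card_n[of "Suc (card (candidates `` {a0}))" "block a0"] by auto
      have BV: "B \<subseteq> V" using B(1) by (auto simp: block_def)
      have "card B + reserve \<le> left" using rounds small lt B(2) by linarith
      then obtain Q where Q: "holds reserve Q" "B \<subseteq> Domain Q" using pick_left[OF BV] by blast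
      have "\<forall>a\<in>B. \<exists>w. (a, w) \<in> Q" using Q(2) by blast
      from bchoice[OF this] obtain g where g: "\<And>a. a \<in> B \<Longrightarrow> (a, g a) \<in> Q" by blast
      have "inj_on g B"
        using partial_iso_eq[OF holds_partial_iso[OF Q(1)] g g] by (intro inj_onI) blast
      moreover have "g ` B \<subseteq> candidates `` {a0}"
      proof
        fix x assume "x \<in> g ` B"
        then obtain c where c: "c \<in> B" "x = g c" by blast
        have "(c, x) \<in> candidates" using g[OF c(1)] c(2) holds_candidates[OF Q(1)] by blast
        moreover have "candidates `` {c} = candidates `` {a0}" using c(1) B(1) by (auto simp: block_def)
        ultimately show "x \<in> candidates `` {a0}" by blast
      qed
      ultimately have "card B \<le> card (candidates `` {a0})" using finite_row by (rule card_inj_on_le)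
      with B(2) show False by simp
    qed
  qed
  then show "card Z div 2 + k < card (block a0)" "card Z div 2 + k < card (candidates `` {a0})"
    by simp_all
qed

lemma block_subset_Z: "block a0 \<subseteq> Z"
proof
  fix c assume c: "c \<in> block a0"
  have "c \<notin> E"
  proof
    assume cE: "c \<in> E"
    \<comment> \<open>An element of the base shares its image with no other element, so its block
      would be a singleton, against the size bound.\<close>
    have "block a0 \<subseteq> {c}"
    proof
      fix d assume d: "d \<in> block a0"
      obtain w where w: "(a0, w) \<in> candidates" using candidates_left_total[OF a0] by blast
      then have "(c, w) \<in> candidates" "(d, w) \<in> candidates" using c d block_eq[OF w] by auto
      then show "d \<in> {c}" using candidates_base cE by auto
    qed
    then have "card (block a0) \<le> card {c}" by (intro card_mono) auto
    then show False using unbalanced_large(1) k_pos by simp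
  qed
  then show "c \<in> Z" using c by (simp add: block_def)
qed

end

text \<open>Two distinct unbalanced blocks would be disjoint subsets of \<open>Z\<close>, each
  larger than half of it.\<close>

lemma unbalanced_unique:
  assumes "a0 \<in> V" "card (block a0) \<noteq> card (candidates `` {a0})"
    "a1 \<in> V" "card (block a1) \<noteq> card (candidates `` {a1})"
  shows "block a1 = block a0" "candidates `` {a1} = candidates `` {a0}"
proof -
  show eq: "candidates `` {a1} = candidates `` {a0}"
  proof (rule ccontr)
    assume "candidates `` {a1} \<noteq> candidates `` {a0}"
    then have "block a0 \<inter> block a1 = {}" by (auto simp: block_def)
    then have "card (block a0) + card (block a1) = card (block a0 \<union> block a1)"
      using finite_block[OF assms(1,2)] by (simp add: card_Un_disjoint)
    also have "\<dots> \<le> card Z"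
      using block_subset_Z[OF assms(1,2)] block_subset_Z[OF assms(3,4)] finite_universe
      by (intro card_mono) auto
    finally show False using unbalanced_large(1)[OF assms(1,2)] unbalanced_large(1)[OF assms(3,4)]
      by linarith
  qed
  then show "block a1 = block a0" by (simp add: block_def)
qed

text \<open>The only unbalanced rectangle, \<open>?K\<close> times \<open>?R\<close>, lies inside
  the similarity class \<open>S\<close> of \<open>a0\<close> times its image \<open>S'\<close>, so
  these differ in size in the same direction. On the larger side the Spoiler selects one element
  more than the smaller one has. The mutually similar answers, transported to \<open>M\<close> if
  necessary, need a class other than \<open>S\<close>, but all others are smaller than both
  \<open>?K\<close> and \<open>?R\<close>.\<close>

lemma isomorphic_if_survives_alt:
  assumes alt: "survives_alt L M N r {}" "survives_alt L N M r {}" and sigma: "sigma L M + k \<le> r"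
  shows "isomorphic L M N"
proof (rule ccontr)
  assume "\<not> isomorphic L M N"
  then obtain a0 where a0: "a0 \<in> V" "card (block a0) \<noteq> card (candidates `` {a0})"
    using isomorphic_if_balanced by blast
  let ?K = "block a0" and ?R = "candidates `` {a0}"
  note large = unbalanced_large[OF a0] and finK = finite_block[OF a0]
  have balanced: "card (block a) = card (candidates `` {a}) \<or>
      block a = ?K \<and> candidates `` {a} = ?R" if "a \<in> V" for a
    using unbalanced_unique[OF a0 that] by blast
  have eqM: "equiv V (similar L M)" and eqN: "equiv W (similar L N)" by (rule equiv_similar)+
  \<comment> \<open>At most \<open>k + 1\<close> elements fit into every rectangle: into a balanced
    one by equality of its sides, into the unbalanced one because both sides exceed
    \<open>k\<close>.\<close>
  have embed_right: "\<exists>h. inj_on h B \<and> (\<forall>w\<in>B. (h w, w) \<in> candidates)"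
    if B: "B \<subseteq> W" "finite B" "card B \<le> k + 1" for B
  proof -
    have "card (B \<inter> candidates `` {a}) \<le> card (block a)" if "(a, w) \<in> candidates" for a w
    proof -
      have "a \<in> V" using that candidates_subset by auto
      moreover have "card (B \<inter> candidates `` {a}) \<le> k + 1"
        using card_mono[OF B(2), of "B \<inter> candidates `` {a}"] B(3) by simp
      moreover have "card (B \<inter> candidates `` {a}) \<le> card (candidates `` {a})"
        by (intro card_mono finite_row) auto
      ultimately show ?thesis using balanced[of a] large(1) by auto
    qed
    then show ?thesis using ex_injection_right[OF B(1)] by metis
  qed
  have embed_left: "\<exists>h. inj_on h A \<and> (\<forall>a\<in>A. (h a, a) \<in> candidates\<inverse>)"
    if A: "A \<subseteq> V" "finite A" "card A \<le> k + 1" for A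
  proof -
    have "card (A \<inter> block a) \<le> card (candidates `` {a})" if "a \<in> A" for a
    proof -
      have "a \<in> V" using that A(1) by auto
      moreover have "card (A \<inter> block a) \<le> k + 1"
        using card_mono[OF A(2), of "A \<inter> block a"] A(3) by simp
      moreover have "card (A \<inter> block a) \<le> card (block a)"
        by (intro card_mono finite_block[OF a0]) auto
      ultimately show ?thesis using balanced[of a] large(2) by auto
    qed
    then obtain h where "inj_on h A" "\<And>a. a \<in> A \<Longrightarrow> (a, h a) \<in> candidates"
      using ex_injection_left[OF A(1)] by blast
    then show ?thesis by (intro exI[of _ h]) auto
  qed
  have transfer: "(w, v) \<in> similar L N"
    if "(a, w) \<in> candidates" "(b, v) \<in> candidates" "(a, b) \<in> similar L M" for a b w v
    by (rule similar_transfer[OF candidates_partial_iso embed_right candidates_similar arity_le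
          candidates_subset that])
  have transfer_back: "(a, b) \<in> similar L M"
    if "(a, w) \<in> candidates" "(b, v) \<in> candidates" "(w, v) \<in> similar L N" for a b w v
  proof (rule similar_transfer[where r = "candidates\<inverse>" and M = N and a = w and b = v])
    show "partial_iso L N M P" if P: "P \<subseteq> candidates\<inverse>"
      "\<And>a b c d. (a, b) \<in> P \<Longrightarrow> (c, d) \<in> P \<Longrightarrow> (a = c) = (b = d)" for P
    proof -
      have "partial_iso L M N (P\<inverse>)" by (rule candidates_partial_iso) (use P in auto)
      then show ?thesis by simp
    qed
    show "\<exists>h. inj_on h A \<and> (\<forall>a\<in>A. (h a, a) \<in> candidates\<inverse>)"
      if "A \<subseteq> V" "finite A" "card A \<le> k + 1" for A by (rule embed_left[OF that])
    \<comment> \<open>This is \<open>transfer\<close> for two images of one element, which explains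
      the order of the two transfers.\<close>
    show "(x, y) \<in> similar L N" if "(x, c) \<in> candidates\<inverse>" "(y, c) \<in> candidates\<inverse>" for x y c
    proof -
      have "c \<in> V" using that candidates_subset by auto
      then have "(c, c) \<in> similar L M" using eqM by (auto simp: equiv_def refl_on_def)
      then show ?thesis using transfer[of c x c y] that by simp
    qed
  qed (use that arity_le candidates_subset in auto)
  define S where "S = similar L M `` {a0}"
  have S: "S \<in> V // similar L M" unfolding S_def using a0 by (auto intro: quotientI)
  have SV: "S \<subseteq> V" by (rule in_quotient_imp_subset[OF eqM S])
  have finS: "finite S" by (rule finite_subset[OF SV finite_universe])
  have S_sim: "(a, b) \<in> similar L M" if "a \<in> S" "b \<in> S" for a b
    using S that eqM by (meson quotient_eq_iff)
  have S_closed: "b \<in> S" if "a \<in> S" "(a, b) \<in> similar L M" for a b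
    using in_quotient_imp_closed[OF eqM S that] .
  have a0S: "a0 \<in> S" using a0 eqM by (auto simp: S_def equiv_def refl_on_def)
  have KS: "?K \<subseteq> S"
  proof
    fix c assume c: "c \<in> ?K"
    obtain w where w: "(a0, w) \<in> candidates" using candidates_left_total[OF a0(1)] by blast
    then have "(c, w) \<in> candidates" using c block_eq[OF w] by auto
    then show "c \<in> S" using candidates_similar[OF w] a0S S_closed by blast
  qed
  have cardS: "card S \<le> sigma L M"
    unfolding sigma_def using S finite_universe eqM
    by (intro Max_ge) (auto simp: finite_quotient equiv_def)
  \<comment> \<open>A class absorbed by the base has at most \<open>2 * k - 1\<close> elements; any
    other has at most \<open>k - 1\<close> in \<open>X\<close> and the rest in
    \<open>Z - ?K\<close>, which is less than half of \<open>Z\<close>. As \<open>?K\<close> fits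
    into \<open>Z\<close>, \<open>large\<close> gives \<open>k \<le> card Z div 2\<close>, and both
    cases stay below the bound.\<close>
  have other: "card T < min (card ?K) (card ?R)" if T: "T \<in> V // similar L M" "T \<noteq> S" for T
  proof -
    have TS: "T \<inter> S = {}" using quotient_disj[OF eqM T(1) S] T(2) by blast
    have finT: "finite T"
      by (rule finite_subset[OF in_quotient_imp_subset[OF eqM T(1)] finite_universe])
    have KZ: "card ?K \<le> card Z"
      using block_subset_Z[OF a0] finite_universe by (intro card_mono) auto
    have "T \<inter> Ys (k - 1) = {} \<and> card (T \<inter> X) \<le> k - 1 \<or> T \<subseteq> E \<and> card T \<le> 2 * k - 1"
      using base T(1) by (simp add: layered_base_def)
    then show ?thesis
    proof
      assume "T \<subseteq> E \<and> card T \<le> 2 * k - 1"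
      then show ?thesis using large KZ k_pos by linarith
    next
      assume a: "T \<inter> Ys (k - 1) = {} \<and> card (T \<inter> X) \<le> k - 1"
      have "T \<subseteq> (T \<inter> X) \<union> (Z - ?K)"
        using a TS KS in_quotient_imp_subset[OF eqM T(1)] by blast
      then have "card T \<le> card ((T \<inter> X) \<union> (Z - ?K))"
        using finT finite_universe by (intro card_mono) auto
      also have "\<dots> \<le> card (T \<inter> X) + card (Z - ?K)" by (rule card_Un_le)
      also have "card (Z - ?K) = card Z - card ?K"
        using block_subset_Z[OF a0] finK by (intro card_Diff_subset)
      finally show ?thesis using a large KZ by linarith
    qed
  qed
  have clique: "\<exists>C\<in>V // similar L M. T \<subseteq> C"
    if T: "T \<subseteq> V" "T \<noteq> {}" "\<And>a b. a \<in> T \<Longrightarrow> b \<in> T \<Longrightarrow> (a, b) \<in> similar L M" for T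
  proof -
    obtain t where t: "t \<in> T" using T(2) by blast
    have "T \<subseteq> similar L M `` {t}" using T(3)[OF t] by blast
    then show ?thesis using t T(1) by (blast intro: quotientI)
  qed
  have finC: "finite C" if "C \<in> V // similar L M" for C
    by (rule finite_subset[OF in_quotient_imp_subset[OF eqM that] finite_universe])
  define S' where "S' = candidates `` S"
  have S'W: "S' \<subseteq> W" using candidates_subset by (auto simp: S'_def)
  have finS': "finite S'" by (rule finite_subset[OF S'W finite_N])
  have RS': "?R \<subseteq> S'" using a0S by (auto simp: S'_def)
  have S'_sim: "(w, v) \<in> similar L N" if "w \<in> S'" "v \<in> S'" for w v
    using that transfer S_sim unfolding S'_def by blast
  show False
  proof (cases "card ?K < card ?R")
    case True
    obtain h where h: "inj_on h V" "\<And>a. a \<in> V \<Longrightarrow> (a, h a) \<in> candidates"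
    proof (rule ex_injection_left[of V])
      fix a assume "a \<in> V"
      moreover have "V \<inter> block a = block a" by (auto simp: block_def)
      ultimately show "card (V \<inter> block a) \<le> card (candidates `` {a})"
        using balanced[of a] True by auto
    qed auto
    \<comment> \<open>\<open>S'\<close> contains the image of \<open>S - ?K\<close> under
      \<open>h\<close> and, disjoint from it, all of \<open>?R\<close>, so it exceeds
      \<open>S\<close> by at least the surplus of \<open>?R\<close> over \<open>?K\<close>.\<close>
    have sub: "h ` (S - ?K) \<union> ?R \<subseteq> S'"
    proof -
      have "h s \<in> S'" if "s \<in> S" for s using h(2) that SV unfolding S'_def by blast
      then show ?thesis using RS' by blast
    qed
    have disj: "h ` (S - ?K) \<inter> ?R = {}"
    proof -
      have "s \<in> ?K" if s: "s \<in> S" "(a0, h s) \<in> candidates" for s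
      proof -
        have "(s, h s) \<in> candidates" using h(2) s(1) SV by blast
        then show ?thesis using block_eq[OF s(2)] by blast
      qed
      then show ?thesis by blast
    qed
    have "card (h ` (S - ?K)) = card S - card ?K"
      using h(1) SV KS finK by (metis Diff_subset card_Diff_subset card_image inj_on_subset)
    moreover have "card (h ` (S - ?K) \<union> ?R) = card (h ` (S - ?K)) + card ?R"
      using disj finS finite_row by (intro card_Un_disjoint) auto
    moreover have "card (h ` (S - ?K) \<union> ?R) \<le> card S'" by (rule card_mono[OF finS' sub])
    moreover have KleS: "card ?K \<le> card S" by (rule card_mono[OF finS KS])
    ultimately have lt: "card S < card S'" using True by linarith
    have "survives_alt L N M (card S + k) {}"
      by (rule survives_alt_antimono[OF nonempty(2,1) _ alt(2)]) (use cardS sigma in linarith)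
    then obtain T where T: "T \<subseteq> V" "card T = Suc (card S)"
      "\<And>a b. a \<in> T \<Longrightarrow> b \<in> T \<Longrightarrow> (a, b) \<in> similar L M"
      using similar_set_survives[OF nonempty(2,1) arity_le k_pos _ S'W lt S'_sim] by blast
    have "T \<noteq> {}" using T(2) by auto
    then have "\<exists>C\<in>V // similar L M. T \<subseteq> C" by (rule clique[OF T(1) _ T(3)])
    then obtain C where C: "C \<in> V // similar L M" "T \<subseteq> C" by blast
    have "card T \<le> card C" by (rule card_mono[OF finC[OF C(1)] C(2)])
    \<comment> \<open>A class with more than \<open>card S\<close> elements is not \<open>S\<close>,
      yet any other class is smaller than \<open>?K\<close>, a subset of \<open>S\<close>.\<close>
    then have "C \<noteq> S" using T(2) by auto
    then show False using other[OF C(1)] \<open>card T \<le> card C\<close> T(2) KleS by linarith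
  next
    case False
    then have lt: "card ?R < card ?K" using a0(2) by simp
    obtain h where h: "inj_on h W" "\<And>w. w \<in> W \<Longrightarrow> (h w, w) \<in> candidates"
    proof (rule ex_injection_right[of W])
      fix a w assume "(a, w) \<in> candidates"
      then have "a \<in> V" "W \<inter> candidates `` {a} = candidates `` {a}" using candidates_subset by auto
      then show "card (W \<inter> candidates `` {a}) \<le> card (block a)" using balanced[of a] lt by auto
    qed auto
    have hS: "h w \<in> S" if "w \<in> S'" for w
    proof -
      obtain s where s: "s \<in> S" "(s, w) \<in> candidates" using \<open>w \<in> S'\<close> by (auto simp: S'_def)
      then have "(s, h w) \<in> similar L M" using h(2) candidates_similar that S'W by blast
      then show ?thesis using S_closed s(1) by blast
    qed
    have sub: "h ` (S' - ?R) \<subseteq> S - ?K"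
    proof
      fix x assume "x \<in> h ` (S' - ?R)"
      then obtain w where w: "w \<in> S'" "w \<notin> ?R" "x = h w" by blast
      have "x \<notin> ?K"
      proof
        assume "x \<in> ?K"
        then have "candidates `` {h w} = ?R" using w(3) by (simp add: block_def)
        moreover have "(h w, w) \<in> candidates" using h(2) w(1) S'W by blast
        ultimately show False using w(2) by blast
      qed
      then show "x \<in> S - ?K" using hS[OF w(1)] w(3) by simp
    qed
    have "inj_on h (S' - ?R)" by (rule inj_on_subset[OF h(1)]) (use S'W in blast)
    then have "card (S' - ?R) \<le> card (S - ?K)"
      by (rule card_inj_on_le[OF _ sub]) (use finS in simp)
    moreover have "card (S' - ?R) = card S' - card ?R" by (rule card_Diff_subset[OF finite_row RS'])
    moreover have "card (S - ?K) = card S - card ?K" by (rule card_Diff_subset[OF finK KS])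
    moreover have RleS: "card ?R \<le> card S'" by (rule card_mono[OF finS' RS'])
    moreover have "card ?K \<le> card S" by (rule card_mono[OF finS KS])
    ultimately have lt': "card S' < card S" using lt by linarith
    have "survives_alt L M N (card S' + k) {}"
      by (rule survives_alt_antimono[OF nonempty _ alt(1)]) (use cardS sigma lt' in linarith)
    then obtain T where T: "T \<subseteq> W" "card T = Suc (card S')"
      "\<And>w v. w \<in> T \<Longrightarrow> v \<in> T \<Longrightarrow> (w, v) \<in> similar L N"
      using similar_set_survives[OF nonempty arity_le k_pos _ SV lt' S_sim] by blast
    have hT: "h ` T \<subseteq> V" using h(2) T(1) candidates_subset by blast
    have hT_sim: "(h w, h v) \<in> similar L M" if wv: "w \<in> T" "v \<in> T" for w v
    proof -
      have "w \<in> W" "v \<in> W" using wv T(1) by blast+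
      then show ?thesis using transfer_back[OF h(2) h(2) T(3)[OF wv]] by blast
    qed
    have "h ` T \<noteq> {}" using T(2) by auto
    then have "\<exists>C\<in>V // similar L M. h ` T \<subseteq> C"
      by (rule clique[OF hT]) (use hT_sim in blast)
    then obtain C where C: "C \<in> V // similar L M" "h ` T \<subseteq> C" by blast
    have cT: "card (h ` T) = card T" using h(1) T(1) by (meson card_image inj_on_subset)
    have TC: "card T \<le> card C" using card_mono[OF finC[OF C(1)] C(2)] cT by simp
    \<comment> \<open>If the transported answers fell into \<open>S\<close>, the answers themselves
      would lie in \<open>S'\<close>, which has one element too few.\<close>
    have "C \<noteq> S"
    proof
      assume "C = S"
      have "T \<subseteq> S'"
      proof
        fix w assume w: "w \<in> T"
        then have "(h w, w) \<in> candidates" "h w \<in> S" using h(2) T(1) C(2) \<open>C = S\<close> by blast+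
        then show "w \<in> S'" by (auto simp: S'_def)
      qed
      then have "card T \<le> card S'" by (rule card_mono[OF finS'])
      with T(2) show False by simp
    qed
    then show False using other[OF C(1)] TC T(2) RleS by linarith
  qed
qed

end

end

section \<open>Choosing the number of rounds\<close>

theorem theorem4p10:
  fixes L :: vocabulary and M :: "'a fo_struct" and n k :: nat
  assumes "vocabulary L" and "L \<noteq> []"
    and "finite_struct M"
    and "struct_order M = n"
    and "max_arity L = k"
  shows "ereal_of_enat (D1 L M) \<le>
    ereal (max ((1 - 1 / (2 * real k)) * real n + real k ^ 2 - real k + 2)
               (real (sigma L M) + real k))"
proof -
  define bound where "bound = max ((1 - 1 / (2 * real k)) * real n + real k ^ 2 - real k + 2)
      (real (sigma L M) + real k)"
  \<comment> \<open>Rounding down loses nothing, as every natural number below the bound is at most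
    \<open>r\<close>.\<close>
  define r where "r = nat \<lfloor>bound\<rfloor>"
  have fin: "finite (universe M)" "universe M \<noteq> {}" using assms(3) by (auto simp: finite_struct_def)
  have arity: "0 < L ! i" "L ! i \<le> k" if "i < length L" for i
    using assms(1,5) that by (auto simp: vocabulary_def max_arity_def)
  have k: "0 < k" using arity[of 0] assms(2) by fastforce
  interpret bounded_arity_struct L M k by unfold_locales (use fin arity k in auto)
  obtain X Ys where base: "layered_base (k - 1) X Ys" using ex_layered_base by blast
  let ?m = "card (V - (X \<union> Ys (k - 1)))"
  have XV: "X \<subseteq> V" using base by (simp add: layered_base_def)
  have le_r: "x \<le> r" if "real x \<le> bound" for x using that unfolding r_def by (rule le_nat_floor)
  have rest: "card X + ((k - 1) * (k - 1) + k + 1 + ?m div 2) \<le> r"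
  proof (rule le_r)
    have "2 * k * card X + k * ?m \<le> (2 * k - 1) * n"
      using layered_base_card[OF base] assms(4) by (simp add: struct_order_def)
    then have "real (2 * k * card X + k * ?m) \<le> real ((2 * k - 1) * n)" by (rule of_nat_mono)
    then have "2 * real k * real (card X) + real k * real ?m \<le> (2 * real k - 1) * real n"
      using k by (simp add: of_nat_diff)
    then have "real (card X) + real ?m / 2 \<le> (1 - 1 / (2 * real k)) * real n"
      using k by (simp add: field_simps)
    moreover have "real (?m div 2) \<le> real ?m / 2"
    proof -
      have "real (2 * (?m div 2)) \<le> real ?m" by (rule of_nat_mono) simp
      then show ?thesis by simp
    qed
    \<comment> \<open>The origin of the additive constant: the reserve, plus \<open>k + 1\<close>
      moves beyond half of the remaining elements.\<close>
    moreover have "real ((k - 1) * (k - 1) + k + 1) = real k ^ 2 - real k + 2"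
      using k by (cases k) (simp_all add: power2_eq_square algebra_simps)
    moreover have "real (card X + ((k - 1) * (k - 1) + k + 1 + ?m div 2)) =
        real (card X) + real ((k - 1) * (k - 1) + k + 1) + real (?m div 2)"
      by simp
    ultimately show "real (card X + ((k - 1) * (k - 1) + k + 1 + ?m div 2)) \<le> bound"
      unfolding bound_def by linarith
  qed
  have sigma: "sigma L M + k \<le> r" by (rule le_r) (simp add: bound_def)
  have "D1 L M \<le> enat r"
  proof (rule D1_le[OF assms(3)])
    show "0 < r" using sigma k by simp
    fix N :: "nat fo_struct"
    assume N: "finite_struct N" and alt: "survives_alt L M N r {}" "survives_alt L N M r {}"
    have finN: "finite (universe N)" "universe N \<noteq> {}" using N by (auto simp: finite_struct_def)
    have "finite X" by (rule finite_subset[OF XV fin(1)])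
    moreover have "card X + (r - card X) \<le> r" using rest by simp
    ultimately obtain Q where Q: "Q \<subseteq> V \<times> universe N" "X \<subseteq> Domain Q" "survives_alt L M N (r - card X) Q"
      using survives_alt_moves[OF fin(2) finN(2) _ XV _ alt(1)] by (metis Un_empty_left)
    \<comment> \<open>\<open>Q\<close> is cut down so that its domain is exactly \<open>X\<close>;
      both survival statements pass to the smaller position.\<close>
    define P0 where "P0 = Q \<inter> X \<times> UNIV"
    interpret base_position L M k N X Ys P0 "r - card X"
    proof unfold_locales
      show "P0 \<subseteq> V \<times> universe N" "Domain P0 = X" using Q(1,2) unfolding P0_def by blast+
      show "survives L M N (r - card X) P0"
        by (rule survives_subset[OF survives_alt_same[OF Q(3)]]) (auto simp: P0_def)
      show "survives L N M (r - card X) (P0\<inverse>)"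
        by (rule survives_subset[OF survives_alt_switch[OF Q(3)]]) (auto simp: P0_def)
      show "(k - 1) * (k - 1) + k + 1 + ?m div 2 \<le> r - card X" using rest by linarith
    qed (use base finN fin in auto)
    obtain F where "forced_matching (k - 1) F" using ex_forced_matching by blast
    then show "isomorphic L M N" by (rule isomorphic_if_survives_alt[OF _ alt sigma])
  qed
  then have "ereal_of_enat (D1 L M) \<le> ereal_of_enat (enat r)"
    by (simp only: ereal_of_enat_le_iff)
  also have "\<dots> = ereal (real r)" by simp
  also have "\<dots> \<le> ereal bound"
  proof -
    have "0 \<le> bound" by (simp add: bound_def le_max_iff_disj)
    then show ?thesis by (simp add: r_def)
  qed
  finally show ?thesis unfolding bound_def .
qed

end
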